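(* Assume the weighted digraph $V$ on vertex set $\mathcal N$ ($|\mathcal N|=N$) has at least one spanning tree. Then for every $k\in\{1,\dots,N\}$, every minimal forest $F\in\tilde{\mathcal F}^k$ and every atom $\mathcal E$ of the algebra $\mathfrak A_k$, the induced subgraph $F|_{\mathcal E}$ is a tree (i.e. it is weakly connected).
   Context: $V$ is a digraph with vertex set $\mathcal N$ and real weights $v_{ij}$ on its arcs $(i,j)$. An (entering) forest is a digraph in which every vertex has at most one outgoing arc and which contains no directed cycle; its weakly connected components are called trees; the unique vertex of a tree with no outgoing arc is its root. A spanning forest is a forest which is a subgraph of $V$ with vertex set $\mathcal N$; $\mathcal F^k$ denotes the set of spanning forests consisting of exactly $k$ trees. For a subgraph $G$ of $V$, $\Upsilon^G=\sum_{(i,j)\in\mathcal AG}v_{ij}$. Put $\phi^k=\min_{F\in\mathcal F^k}\Upsilon^F$ and $\tilde{\mathcal F}^k=\{F\in\mathcal F^k:\Upsilon^F=\phi^k\}$ (minimal forests). $\mathfrak A_k$ is the algebra of subsets of $\mathcal N$ generated (by taking complements and intersections) by the vertex sets of all trees of all forests in $\tilde{\mathcal F}^k$. An atom of $\mathfrak A_k$ is a nonempty $\mathcal A\in\mathfrak A_k$ such that $\mathcal A\cap\mathcal B\in\{\emptyset,\mathcal A\}$ for all $\mathcal B\in\mathfrak A_k$. For a digraph $G$ and $\mathcal S\subseteq\mathcal N$, $G|_{\mathcal S}$ is the subgraph induced by $\mathcal S$ (vertex set $\mathcal S$, all arcs of $G$ with both ends in $\mathcal S$). A graph with a single vertex and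 no arcs counts as a tree. *)

theory Defs
  imports Complex_Main
begin

text \<open>A digraph is given by a vertex set Vs and an arc set As \<subseteq> Vs \<times> Vs.
  A subgraph with a given vertex set is represented by its arc set.\<close>

definition digraph :: "'a set \<Rightarrow> ('a \<times> 'a) set \<Rightarrow> bool" where
  "digraph Vs As \<longleftrightarrow> As \<subseteq> Vs \<times> Vs"

text \<open>Entering forest: every vertex has at most one outgoing arc, no directed cycle.\<close>
definition is_forest :: "'a set \<Rightarrow> ('a \<times> 'a) set \<Rightarrow> bool" where
  "is_forest Vs F \<longleftrightarrow> digraph Vs F \<and>
     (\<forall>i\<in>Vs. \<forall>j1 j2. (i, j1) \<in> F \<and> (i, j2) \<in> F \<longrightarrow> j1 = j2) \<and> acyclic F"

text \<open>Weak connectivity relation (on vertices of Vs) and weakly connected components.\<close>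
definition weak_rel :: "'a set \<Rightarrow> ('a \<times> 'a) set \<Rightarrow> ('a \<times> 'a) set" where
  "weak_rel Vs F = ((F \<union> F\<inverse>)\<^sup>* \<inter> (Vs \<times> Vs))"

definition components :: "'a set \<Rightarrow> ('a \<times> 'a) set \<Rightarrow> 'a set set" where
  "components Vs F = Vs // weak_rel Vs F"

definition weakly_connected :: "'a set \<Rightarrow> ('a \<times> 'a) set \<Rightarrow> bool" where
  "weakly_connected Vs F \<longleftrightarrow> Vs \<noteq> {} \<and> (\<forall>x\<in>Vs. \<forall>y\<in>Vs. (x, y) \<in> (F \<union> F\<inverse>)\<^sup>*)"

text \<open>A tree: a weakly connected forest (a single vertex with no arcs counts).\<close>
definition is_tree :: "'a set \<Rightarrow> ('a \<times> 'a) set \<Rightarrow> bool" where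
  "is_tree Vs F \<longleftrightarrow> is_forest Vs F \<and> weakly_connected Vs F"

text \<open>Spanning forests of (Vs, As) with exactly k trees.\<close>
definition spanning_forests :: "'a set \<Rightarrow> ('a \<times> 'a) set \<Rightarrow> nat \<Rightarrow> ('a \<times> 'a) set set" where
  "spanning_forests Vs As k = {F. F \<subseteq> As \<and> is_forest Vs F \<and> card (components Vs F) = k}"

definition weight :: "('a \<Rightarrow> 'a \<Rightarrow> real) \<Rightarrow> ('a \<times> 'a) set \<Rightarrow> real" where
  "weight v G = (\<Sum>(i, j)\<in>G. v i j)"

definition phi :: "'a set \<Rightarrow> ('a \<times> 'a) set \<Rightarrow> ('a \<Rightarrow> 'a \<Rightarrow> real) \<Rightarrow> nat \<Rightarrow> real" where
  "phi Vs As v k = Min (weight v ` spanning_forests Vs As k)"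

definition minimal_forests ::
  "'a set \<Rightarrow> ('a \<times> 'a) set \<Rightarrow> ('a \<Rightarrow> 'a \<Rightarrow> real) \<Rightarrow> nat \<Rightarrow> ('a \<times> 'a) set set" where
  "minimal_forests Vs As v k = {F \<in> spanning_forests Vs As k. weight v F = phi Vs As v k}"

text \<open>Algebra of subsets of Vs generated (by complements in Vs and intersections) by Gs.\<close>
inductive_set gen_algebra :: "'a set \<Rightarrow> 'a set set \<Rightarrow> 'a set set" for Vs Gs where
  gen: "X \<in> Gs \<Longrightarrow> X \<in> gen_algebra Vs Gs"
| top: "Vs \<in> gen_algebra Vs Gs"
| compl: "X \<in> gen_algebra Vs Gs \<Longrightarrow> Vs - X \<in> gen_algebra Vs Gs"
| inter: "X \<in> gen_algebra Vs Gs \<Longrightarrow> Y \<in> gen_algebra Vs Gs \<Longrightarrow> X \<inter> Y \<in> gen_algebra Vs Gs"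

definition algebra_k ::
  "'a set \<Rightarrow> ('a \<times> 'a) set \<Rightarrow> ('a \<Rightarrow> 'a \<Rightarrow> real) \<Rightarrow> nat \<Rightarrow> 'a set set" where
  "algebra_k Vs As v k =
     gen_algebra Vs (\<Union>F\<in>minimal_forests Vs As v k. components Vs F)"

definition is_atom :: "'a set set \<Rightarrow> 'a set \<Rightarrow> bool" where
  "is_atom Alg E \<longleftrightarrow> E \<in> Alg \<and> E \<noteq> {} \<and> (\<forall>B\<in>Alg. E \<inter> B \<in> {{}, E})"

text \<open>Arc set of the subgraph induced by S.\<close>
definition induced :: "('a \<times> 'a) set \<Rightarrow> 'a set \<Rightarrow> ('a \<times> 'a) set" where
  "induced G S = G \<inter> (S \<times> S)"

end

theory Submission
  imports Defs
begin

text \<open>A swap of one tree between two forests shows that \<open>\<phi>\<close> is convex in \<open>k\<close>, so for a suitable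
  cost \<open>l\<close> per root the minimal \<open>k\<close>-forests are exactly the forests with \<open>k\<close> roots that minimise
  weight plus root costs among all spanning forests. By the primal-dual algorithm for minimum
  arborescences, optimality means: only arcs and roots of zero reduced cost are used, and
  every set of a certain laminar family is left exactly once. Contracting the maximal sets of
  this family, every acyclic choice of the available exits is again optimal, which makes the
  problem unweighted.

  If \<open>F\<close> left an atom \<open>E\<close> at two vertices \<open>x\<close> and \<open>y\<close>, say \<open>x\<close> to \<open>z\<close> outside \<open>E\<close> with \<open>x\<close> not
  on the \<open>F\<close>-path of \<open>y\<close>, take an optimal \<open>G\<close> separating \<open>z\<close> from \<open>E\<close>. Combining paths of \<open>F\<close> and
  \<open>G\<close> gives an optimal forest with \<open>k\<close> trees separating \<open>x\<close> from \<open>y\<close>, which is impossible in an atom.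
  So \<open>F\<close> leaves \<open>E\<close> at exactly one vertex, and every vertex of \<open>E\<close> reaches it inside \<open>E\<close>.\<close>

section \<open>Forests as successor functions\<close>

text \<open>Weight alone supports no exchange argument: combining paths of two minimal forests need
  not give a minimal one. The dual solution turns minimality into conditions on single choices,
  except that leaving a set exactly once ties its vertices together. So inside a maximal set an
  optimal forest is copied as a whole, while between maximal sets choices combine freely as long as
  no cycle arises. Having one exit, such a set has a single root for all its vertices in every
  optimal forest, so contraction loses nothing about which vertices are separated.

  Optimality with root costs does not fix the number of roots: if \<open>\<phi>\<close> is linear
  near \<open>k\<close>, optima with other root numbers can occur. Hence the combinatorial core must
  separate two vertices and count roots at the same time.

  In the encoding by successor functions, \<open>None\<close> acts as an arc to a common super-root.
  Roots and arcs become choices of one kind, every vertex makes exactly one choice, and forests are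
  arborescences into the super-root. \<open>leads\<close> is inductive, so it asserts termination
  and replaces acyclicity.\<close>

inductive leads :: "('a \<Rightarrow> 'a option) \<Rightarrow> 'a \<Rightarrow> 'a \<Rightarrow> bool" for f where
  leads_root: "f v = None \<Longrightarrow> leads f v v"
| leads_step: "f v = Some u \<Longrightarrow> leads f u r \<Longrightarrow> leads f v r"

definition fclosed :: "('a \<Rightarrow> 'a option) \<Rightarrow> 'a set \<Rightarrow> bool" where
  "fclosed f X \<longleftrightarrow> (\<forall>v\<in>X. f v \<in> insert None (Some ` X))"

text \<open>\<open>Op\<close> lists the permitted choices, with \<open>(v, None)\<close> permitting
  \<open>v\<close> to be a root. Values of \<open>f\<close> outside \<open>X\<close> are left
  free.\<close>

definition forest :: "'a set \<Rightarrow> ('a \<times> 'a option) set \<Rightarrow> ('a \<Rightarrow> 'a option) \<Rightarrow> bool" where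
  "forest X Op f \<longleftrightarrow> fclosed f X \<and> (\<forall>v\<in>X. (v, f v) \<in> Op \<and> (\<exists>r. leads f v r))"

definition roots :: "'a set \<Rightarrow> ('a \<Rightarrow> 'a option) \<Rightarrow> 'a set" where
  "roots X f = {v \<in> X. f v = None}"

text \<open>A root in \<open>S\<close> counts as an exit, since its arc to the super-root leaves
  every set.\<close>

definition exits :: "('a \<Rightarrow> 'a option) \<Rightarrow> 'a set \<Rightarrow> 'a set" where
  "exits f S = {v \<in> S. f v \<notin> Some ` S}"

definition mix :: "'a set \<Rightarrow> ('a \<Rightarrow> 'a option) \<Rightarrow> ('a \<Rightarrow> 'a option) \<Rightarrow> 'a \<Rightarrow> 'a option" where
  "mix D g f = (\<lambda>v. if v \<in> D then g v else f v)"

definition orbit :: "('a \<Rightarrow> 'a option) \<Rightarrow> 'a \<Rightarrow> 'a set" where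
  "orbit f v = {u. (v, u) \<in> {(a, b). f a = Some b}\<^sup>*}"

lemma leads_None: "leads f v r \<Longrightarrow> f r = None"
  by (induction rule: leads.induct) auto

lemma leads_unique: "leads f v r \<Longrightarrow> leads f v s \<Longrightarrow> r = s"
proof (induction rule: leads.induct)
  case (leads_root v)
  from leads_root.prems leads_root.hyps show ?case by (cases rule: leads.cases) auto
next
  case (leads_step v u r)
  from leads_step.prems leads_step.hyps show ?case
    by (cases rule: leads.cases) (auto intro: leads_step.IH)
qed

lemma leads_stepD: "leads f v r \<Longrightarrow> f v = Some u \<Longrightarrow> leads f u r"
  by (erule leads.cases) auto

lemma leads_fclosed: "leads f v r \<Longrightarrow> fclosed f X \<Longrightarrow> v \<in> X \<Longrightarrow> r \<in> X"
  by (induction rule: leads.induct) (force simp: fclosed_def)+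

lemma leads_cong_on:
  "leads f v r \<Longrightarrow> fclosed f X \<Longrightarrow> v \<in> X \<Longrightarrow> \<forall>u\<in>X. g u = f u \<Longrightarrow> leads g v r"
proof (induction rule: leads.induct)
  case (leads_root v)
  then show ?case by (simp add: leads.leads_root)
next
  case (leads_step v u r)
  then have "u \<in> X" by (force simp: fclosed_def)
  with leads_step show ?case by (metis leads.leads_step)
qed

text \<open>Follow \<open>f\<close> until the path enters \<open>D\<close>; being closed under
  \<open>g\<close>, \<open>D\<close> is never left again, so the two functions cannot alternate into
  a cycle.\<close>

lemma leads_mix:
  assumes "leads f v r" "fclosed g D" "\<forall>u\<in>D. \<exists>s. leads g u s"
  shows "\<exists>s. leads (mix D g f) v s"
proof -
  have D: "\<exists>s. leads (mix D g f) v s" if "v \<in> D" for v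
    using that assms(2,3) leads_cong_on[of g v _ D "mix D g f"] by (auto simp: mix_def)
  from assms(1) show ?thesis
  proof (induction rule: leads.induct)
    case (leads_root v)
    then show ?case using D[of v] leads.leads_root[of "mix D g f" v]
      by (cases "v \<in> D") (auto simp: mix_def)
  next
    case (leads_step v u r)
    then show ?case using D[of v] leads.leads_step[of "mix D g f" v u]
      by (cases "v \<in> D") (auto simp: mix_def)
  qed
qed

lemma exits_nonempty: "leads f v r \<Longrightarrow> v \<in> S \<Longrightarrow> exits f S \<noteq> {}"
proof (induction rule: leads.induct)
  case (leads_root v)
  then show ?case by (auto simp: exits_def)
next
  case (leads_step v u r)
  then show ?case by (cases "u \<in> S") (auto simp: exits_def)
qed

lemma orbit_self: "v \<in> orbit f v"
  by (simp add: orbit_def)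

lemma fclosed_orbit: "fclosed f (orbit f v)"
proof -
  have "f u \<in> insert None (Some ` orbit f v)" if "u \<in> orbit f v" for u
  proof (cases "f u")
    case (Some w)
    then have "w \<in> orbit f v" using that unfolding orbit_def
      by (auto intro: rtrancl_into_rtrancl)
    with Some show ?thesis by auto
  qed auto
  then show ?thesis by (auto simp: fclosed_def)
qed

lemma orbit_subset: "fclosed f X \<Longrightarrow> v \<in> X \<Longrightarrow> orbit f v \<subseteq> X"
proof
  fix u assume X: "fclosed f X" "v \<in> X" "u \<in> orbit f v"
  then have "(v, u) \<in> {(a, b). f a = Some b}\<^sup>*" by (simp add: orbit_def)
  then show "u \<in> X" using X(1,2)
    by (induction rule: rtrancl_induct) (force simp: fclosed_def)+
qed

lemma leads_no_cycle: "leads f v r \<Longrightarrow> (v, v) \<notin> {(a, b). f a = Some b}\<^sup>+"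
proof (induction rule: leads.induct)
  case (leads_root v)
  then show ?case by (auto dest!: tranclD)
next
  case (leads_step v u r)
  show ?case
  proof
    assume "(v, v) \<in> {(a, b). f a = Some b}\<^sup>+"
    then have "(u, v) \<in> {(a, b). f a = Some b}\<^sup>*"
      using leads_step.hyps(1) by (auto dest!: tranclD)
    moreover have "(v, u) \<in> {(a, b). f a = Some b}" using leads_step.hyps(1) by auto
    ultimately have "(u, u) \<in> {(a, b). f a = Some b}\<^sup>+" by (rule rtrancl_into_trancl1)
    with leads_step.IH show False by blast
  qed
qed

lemma orbit_antisym:
  assumes "leads f x r" "y \<in> orbit f x" "x \<in> orbit f y"
  shows "x = y"
proof (rule ccontr)
  assume "x \<noteq> y"
  then have "(x, y) \<in> {(a, b). f a = Some b}\<^sup>+" using assms(2)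
    by (simp add: orbit_def rtrancl_eq_or_trancl)
  then have "(x, x) \<in> {(a, b). f a = Some b}\<^sup>+" using assms(3)
    by (simp add: orbit_def)
  with leads_no_cycle[OF assms(1)] show False by blast
qed

lemma orbit_leads: "leads f v r \<Longrightarrow> u \<in> orbit f v \<Longrightarrow> leads f u r"
proof -
  assume a: "leads f v r" "u \<in> orbit f v"
  then have "(v, u) \<in> {(a, b). f a = Some b}\<^sup>*" by (simp add: orbit_def)
  then show "leads f u r" using a(1)
    by (induction rule: rtrancl_induct) (auto intro: leads_stepD)
qed

lemma forest_mono: "forest X Op f \<Longrightarrow> Op \<subseteq> Op' \<Longrightarrow> forest X Op' f"
  by (auto simp: forest_def)

lemma forest_leads: "forest X Op f \<Longrightarrow> v \<in> X \<Longrightarrow> \<exists>r\<in>roots X f. leads f v r"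
  unfolding forest_def roots_def using leads_fclosed leads_None by fastforce

lemma forest_mix:
  assumes f: "forest X Op f" and g: "forest X Op g" and D: "fclosed g D" "D \<subseteq> X"
  shows "forest X Op (mix D g f)"
proof -
  have "\<exists>s. leads (mix D g f) v s" if v: "v \<in> X" for v
  proof -
    obtain r where "leads f v r" using f v by (auto simp: forest_def)
    moreover have "\<forall>u\<in>D. \<exists>s. leads g u s" using g D by (auto simp: forest_def)
    ultimately show ?thesis using D(1) leads_mix by metis
  qed
  moreover have "fclosed (mix D g f) X" using f g by (auto simp: forest_def fclosed_def mix_def)
  moreover have "\<forall>v\<in>X. (v, mix D g f v) \<in> Op" using f g by (auto simp: forest_def mix_def)
  ultimately show ?thesis by (auto simp: forest_def)
qed

lemma forest_cut:
  assumes f: "forest X Op f" and R: "\<forall>v\<in>R. (v, None) \<in> Op"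
  shows "forest X Op (mix R (\<lambda>_. None) f)"
proof -
  have "\<exists>s. leads (mix R (\<lambda>_. None) f) v s" if v: "v \<in> X" for v
  proof -
    obtain r where "leads f v r" using f v by (auto simp: forest_def)
    then show ?thesis using leads_mix[of f v r "\<lambda>_. None" R] by (auto simp: fclosed_def intro: leads_root)
  qed
  then show ?thesis using f R by (auto simp: forest_def fclosed_def mix_def)
qed

text \<open>The new root \<open>s\<close> lies on the old path of \<open>v\<close>, so turning
  \<open>R\<close> into roots splits trees but never merges them.\<close>

lemma leads_cut: "leads f v r \<Longrightarrow> leads (mix R (\<lambda>_. None) f) v s \<Longrightarrow> leads f s r"
proof (induction rule: leads.induct)
  case (leads_root v)
  then have "mix R (\<lambda>_. None) f v = None" by (simp add: mix_def)
  then have "s = v" using leads_root.prems leads_unique leads.leads_root by metis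
  then show ?case using leads_root by (simp add: leads.leads_root)
next
  case (leads_step v u r)
  show ?case
  proof (cases "v \<in> R")
    case True
    then have "mix R (\<lambda>_. None) f v = None" by (simp add: mix_def)
    then have "s = v" using leads_step.prems leads_unique leads.leads_root by metis
    then show ?thesis using leads_step.hyps leads.leads_step by metis
  next
    case False
    then have "mix R (\<lambda>_. None) f v = Some u" using leads_step.hyps by (simp add: mix_def)
    then show ?thesis using leads_stepD leads_step by metis
  qed
qed

text \<open>Vertices are added to \<open>D\<close> one at a time: the escape condition for
  \<open>C = X - D\<close> supplies a vertex whose choice is \<open>None\<close> or points into
  \<open>D\<close>, where paths are known to end.\<close>

lemma extend_forest:
  assumes "finite X" "D \<subseteq> X" "forest D Op f"
    and "\<And>C. C \<subseteq> X - D \<Longrightarrow> C \<noteq> {} \<Longrightarrow> \<exists>v\<in>C. \<exists>w. (v, w) \<in> Op \<and> w \<in> insert None (Some ` (X - C))"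
  shows "\<exists>g. forest X Op g \<and> (\<forall>v\<in>D. g v = f v)"
  using assms(2-)
proof (induction "card (X - D)" arbitrary: D f rule: less_induct)
  case less
  show ?case
  proof (cases "X = D")
    case True
    with less.prems show ?thesis by blast
  next
    case False
    then have "X - D \<noteq> {}" using less.prems by blast
    then obtain v w where v: "v \<in> X - D" and w: "(v, w) \<in> Op" "w \<in> insert None (Some ` (X - (X - D)))"
      using less.prems(3)[of "X - D"] by blast
    define f' where "f' = f(v := w)"
    have wD: "w \<in> insert None (Some ` D)" using w(2) less.prems(1) by auto
    have fD: "fclosed f D" using less.prems(2) by (simp add: forest_def)
    have lead: "\<exists>r. leads f' u r" if u: "u \<in> D" for u
    proof -
      obtain r where "leads f u r" using less.prems(2) u by (auto simp: forest_def)
      then have "leads f' u r" using leads_cong_on[of f u r D f'] fD u v by (auto simp: f'_def)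
      then show ?thesis by blast
    qed
    moreover have "\<exists>r. leads f' v r"
    proof (cases w)
      case None
      then have "leads f' v v" by (simp add: f'_def leads_root)
      then show ?thesis by blast
    next
      case (Some u)
      then have "u \<in> D" using wD by auto
      then obtain r where "leads f' u r" using lead by blast
      then have "leads f' v r" using Some by (intro leads_step[of f' v u]) (auto simp: f'_def)
      then show ?thesis by blast
    qed
    ultimately have f': "forest (insert v D) Op f'"
      using less.prems(2) wD w(1) v unfolding forest_def fclosed_def by (auto simp: f'_def)
    have "card (X - insert v D) < card (X - D)"
      using v assms(1) by (intro psubset_card_mono) auto
    moreover have "insert v D \<subseteq> X" using v less.prems(1) by blast
    moreover have "\<exists>v\<in>C. \<exists>w. (v, w) \<in> Op \<and> w \<in> insert None (Some ` (X - C))"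
      if "C \<subseteq> X - insert v D" "C \<noteq> {}" for C
      using that by (intro less.prems(3)) auto
    ultimately obtain g where "forest X Op g" "\<forall>u\<in>insert v D. g u = f' u"
      using less.hyps[of "insert v D" f'] f' by metis
    then show ?thesis using v by (intro exI[of _ g]) (auto simp: f'_def)
  qed
qed

section \<open>Optimal forests and laminar families\<close>

definition arcs_of :: "('a \<times> 'a option) set \<Rightarrow> ('a \<times> 'a option) set" where
  "arcs_of Op = {(v, w) \<in> Op. w \<noteq> None}"

definition laminar :: "'a set set \<Rightarrow> bool" where
  "laminar L \<longleftrightarrow> (\<forall>S\<in>L. \<forall>S'\<in>L. S \<subseteq> S' \<or> S' \<subseteq> S \<or> S \<inter> S' = {})"

text \<open>The target \<open>e\<close> is arbitrary because rerouting has to keep whichever exit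
  the given forest uses. Only \<open>e\<close> may choose \<open>None\<close>, so \<open>g\<close>
  is an in-tree of \<open>S\<close> ending at \<open>e\<close>.\<close>

definition tree_reroutable :: "('a \<times> 'a option) set \<Rightarrow> 'a set set \<Rightarrow> 'a set \<Rightarrow> bool" where
  "tree_reroutable Op L S \<longleftrightarrow> (\<forall>e\<in>S. \<exists>g. forest S (insert (e, None) (arcs_of Op)) g
      \<and> (\<forall>S'\<in>L. S' \<subseteq> S \<longrightarrow> card (exits g S') = 1))"

text \<open>Here \<open>e\<close> is where the path of \<open>v\<close> visits \<open>S\<close> for
  the last time, and \<open>W\<close> contains the rest of the path.\<close>

lemma last_exit:
  assumes "leads f v r" "v \<in> S"
  shows "\<exists>e\<in>S. \<forall>u. f e = Some u \<longrightarrow> (\<exists>W. u \<in> W \<and> fclosed f W \<and> W \<inter> S = {})"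
proof -
  let ?E = "\<exists>e\<in>S. \<forall>u. f e = Some u \<longrightarrow> (\<exists>W. u \<in> W \<and> fclosed f W \<and> W \<inter> S = {})"
  have "(\<exists>W. v \<in> W \<and> fclosed f W \<and> W \<inter> S = {}) \<or> ?E"
    using assms(1)
  proof (induction rule: leads.induct)
    case (leads_root v)
    show ?case
    proof (cases "v \<in> S")
      case True
      then show ?thesis using leads_root by (intro disjI2 bexI[of _ v]) auto
    next
      case False
      then show ?thesis using leads_root by (intro disjI1 exI[of _ "{v}"]) (auto simp: fclosed_def)
    qed
  next
    case (leads_step v u r)
    from leads_step.IH show ?case
    proof
      assume "\<exists>W. u \<in> W \<and> fclosed f W \<and> W \<inter> S = {}"
      then obtain W where W: "u \<in> W" "fclosed f W" "W \<inter> S = {}" by blast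
      show ?thesis
      proof (cases "v \<in> S")
        case True
        then show ?thesis using leads_step.hyps(1) W by (intro disjI2 bexI[of _ v]) auto
      next
        case False
        then have "insert v W \<inter> S = {}" using W by blast
        moreover have "fclosed f (insert v W)" using W leads_step.hyps(1) by (auto simp: fclosed_def)
        ultimately show ?thesis by blast
      qed
    qed blast
  qed
  then show ?thesis using assms(2) by blast
qed

text \<open>Inside \<open>S\<close> the forest is replaced by an in-tree towards the last exit
  \<open>e\<close>, whose own choice is kept. Everything in \<open>S\<close> flows to
  \<open>e\<close> and never returns, so no cycle arises. Supersets can only lose exits, since all
  vertices of \<open>S\<close> but \<open>e\<close> now point into \<open>S\<close>.\<close>

lemma reroute_set:
  assumes f: "forest X Op f" and S: "S \<subseteq> X" "S \<noteq> {}" and L: "tree_reroutable Op L S"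
  obtains f' e where "forest X Op f'" "e \<in> S" "exits f' S = {e}"
    "\<And>S'. S' \<in> L \<Longrightarrow> S' \<subseteq> S \<Longrightarrow> card (exits f' S') = 1"
    "\<And>S'. S \<inter> S' = {} \<Longrightarrow> exits f' S' = exits f S'"
    "\<And>S'. S \<subseteq> S' \<Longrightarrow> exits f' S' \<subseteq> exits f S'"
proof -
  obtain v where v: "v \<in> S" using S by blast
  then obtain r where "leads f v r" using f S by (auto simp: forest_def)
  from last_exit[OF this v] obtain e where e: "e \<in> S"
    and W: "\<And>u. f e = Some u \<Longrightarrow> \<exists>W. u \<in> W \<and> fclosed f W \<and> W \<inter> S = {}" by blast
  obtain g where g: "forest S (insert (e, None) (arcs_of Op)) g"
    and gL: "\<forall>S'\<in>L. S' \<subseteq> S \<longrightarrow> card (exits g S') = 1"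
    using L e by (auto simp: tree_reroutable_def)
  have gS: "g v \<in> Some ` S" "(v, g v) \<in> Op" if "v \<in> S" "v \<noteq> e" for v
  proof -
    have "(v, g v) \<in> insert (e, None) (arcs_of Op)" "g v \<in> insert None (Some ` S)"
      using g that(1) by (auto simp: forest_def fclosed_def)
    then show "g v \<in> Some ` S" "(v, g v) \<in> Op" using that(2) by (auto simp: arcs_of_def)
  qed
  have ge: "g e = None"
  proof -
    obtain r where r: "leads g e r" using g e by (auto simp: forest_def)
    then have "r \<in> S" "g r = None" using g e leads_fclosed leads_None by (auto simp: forest_def)
    then have "r = e" using gS by force
    then show ?thesis using \<open>g r = None\<close> by simp
  qed
  have fe: "f e \<notin> Some ` S" using W by fastforce
  define f' where "f' = mix (S - {e}) g f"
  have f'e: "f' e = f e" by (simp add: f'_def mix_def)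
  have f'S: "f' v = g v" if "v \<in> S" "v \<noteq> e" for v using that by (simp add: f'_def mix_def)
  have f'n: "f' v = f v" if "v \<notin> S" for v using that by (simp add: f'_def mix_def)
  have le: "\<exists>r. leads f' e r"
  proof (cases "f e")
    case None
    then have "leads f' e e" using f'e by (simp add: leads_root)
    then show ?thesis by blast
  next
    case (Some u)
    then obtain W where W: "u \<in> W" "fclosed f W" "W \<inter> S = {}" using W by blast
    have "u \<in> X" using f e S Some by (force simp: forest_def fclosed_def)
    then obtain r where "leads f u r" using f by (auto simp: forest_def)
    then have "leads f' u r" using W f'n by (intro leads_cong_on[of f u r W f']) auto
    then have "leads f' e r" using Some f'e leads_step[of f' e u r] by simp
    then show ?thesis by blast
  qed
  have lS: "\<exists>r. leads f' v r" if vS: "v \<in> S" for v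
  proof -
    obtain s where "leads g v s" using g vS by (auto simp: forest_def)
    then show ?thesis using vS
    proof (induction rule: leads.induct)
      case (leads_root v)
      then have "v = e" using gS by force
      then show ?case using le by simp
    next
      case (leads_step v u r)
      show ?case
      proof (cases "v = e")
        case False
        then have "u \<in> S" "f' v = Some u" using gS[of v] leads_step f'S by auto
        then show ?thesis using leads_step.IH leads.leads_step by metis
      qed (use le in simp)
    qed
  qed
  have "\<exists>r. leads f' v r" if vX: "v \<in> X" for v
  proof -
    obtain s where "leads f v s" using f vX by (auto simp: forest_def)
    then show ?thesis
    proof (induction rule: leads.induct)
      case (leads_root v)
      show ?case
      proof (cases "v \<in> S")
        case False
        then have "f' v = None" using leads_root f'n by simp
        then show ?thesis using leads.leads_root by metis
      qed (use lS in blast)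
    next
      case (leads_step v u r)
      show ?case
      proof (cases "v \<in> S")
        case False
        then have "f' v = Some u" using leads_step f'n by simp
        then show ?thesis using leads_step.IH leads.leads_step by metis
      qed (use lS in blast)
    qed
  qed
  moreover have "(v, f' v) \<in> Op \<and> f' v \<in> insert None (Some ` X)" if "v \<in> X" for v
    using that f gS[of v] S f'S[of v] f'n[of v] f'e
    by (cases "v \<in> S"; cases "v = e") (auto simp: forest_def fclosed_def)
  ultimately have 1: "forest X Op f'" by (auto simp: forest_def fclosed_def)
  have 2: "exits f' S = {e}"
  proof -
    have "f' v \<in> Some ` S" if "v \<in> S" "v \<noteq> e" for v using that f'S gS by simp
    moreover have "f' e \<notin> Some ` S" using fe f'e by simp
    ultimately show ?thesis using e unfolding exits_def by blast
  qed
  have "exits f' S' = exits g S'" if "S' \<subseteq> S" for S'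
  proof -
    have "f' v \<in> Some ` S' \<longleftrightarrow> g v \<in> Some ` S'" if "v \<in> S'" for v
    proof (cases "v = e")
      case True
      then show ?thesis using \<open>S' \<subseteq> S\<close> fe f'e ge by auto
    next
      case False
      then have "f' v = g v" using f'S that \<open>S' \<subseteq> S\<close> by blast
      then show ?thesis by simp
    qed
    then show ?thesis by (auto simp: exits_def)
  qed
  then have 3: "card (exits f' S') = 1" if "S' \<in> L" "S' \<subseteq> S" for S' using that gL by simp
  have 4: "exits f' S' = exits f S'" if "S \<inter> S' = {}" for S'
  proof -
    have "f' v = f v" if "v \<in> S'" for v using that \<open>S \<inter> S' = {}\<close> f'n by blast
    then show ?thesis by (auto simp: exits_def)
  qed
  have 5: "exits f' S' \<subseteq> exits f S'" if "S \<subseteq> S'" for S'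
  proof
    fix v assume v: "v \<in> exits f' S'"
    have "f' v \<in> Some ` S'" if "v \<in> S" "v \<noteq> e"
      using that gS(1)[of v] f'S[of v] \<open>S \<subseteq> S'\<close> by auto
    then have "\<not> (v \<in> S \<and> v \<noteq> e)" using v unfolding exits_def by blast
    then have "f' v = f v" using f'e f'n by blast
    then show "v \<in> exits f S'" using v by (auto simp: exits_def)
  qed
  show thesis using that[OF 1 e 2 3 4 5] by blast
qed

lemma forest_exits_card:
  assumes "finite X" "forest X Op f" "S \<subseteq> X" "S \<noteq> {}"
  shows "card (exits f S) \<ge> 1"
proof -
  obtain v where v: "v \<in> S" using assms by blast
  then obtain r where "leads f v r" using assms by (auto simp: forest_def)
  then have "exits f S \<noteq> {}" using v exits_nonempty by metis
  moreover have "finite (exits f S)"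
    using assms finite_subset[of S X] by (auto simp: exits_def)
  ultimately show ?thesis by (simp add: Suc_leI card_gt_0_iff)
qed

text \<open>Induction on the number of sets not left exactly once. Rerouting a bad set repairs it
  and spoils no good one: subsets are handled by the in-tree, disjoint sets are untouched, and
  supersets gain no exit but keep at least one.\<close>

lemma exists_single_exit_forest:
  assumes X: "finite X" and "forest X Op f"
    and L: "laminar L" "\<And>S. S \<in> L \<Longrightarrow> S \<subseteq> X \<and> S \<noteq> {} \<and> tree_reroutable Op L S"
  shows "\<exists>g. forest X Op g \<and> (\<forall>S\<in>L. card (exits g S) = 1)"
  using assms(2)
proof (induction "card {S \<in> L. card (exits f S) \<noteq> 1}" arbitrary: f rule: less_induct)
  case less
  have "L \<subseteq> Pow X" using L by blast
  then have fin: "finite L" using X finite_subset by auto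
  show ?case
  proof (cases "\<forall>S\<in>L. card (exits f S) = 1")
    case True
    then show ?thesis using less.prems by blast
  next
    case False
    then obtain S where S: "S \<in> L" "card (exits f S) \<noteq> 1" by blast
    obtain f' e where f': "forest X Op f'" "e \<in> S" "exits f' S = {e}"
      "\<And>S'. S' \<in> L \<Longrightarrow> S' \<subseteq> S \<Longrightarrow> card (exits f' S') = 1"
      "\<And>S'. S \<inter> S' = {} \<Longrightarrow> exits f' S' = exits f S'"
      "\<And>S'. S \<subseteq> S' \<Longrightarrow> exits f' S' \<subseteq> exits f S'"
      using reroute_set[OF less.prems, of S L] L(2)[OF S(1)] by metis
    have "card (exits f' S') = 1" if S': "S' \<in> L" "card (exits f S') = 1" for S'
    proof -
      consider "S' \<subseteq> S" | "S \<inter> S' = {}" | "S \<subseteq> S'"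
        using L(1) S(1) S'(1) by (auto simp: laminar_def)
      then show ?thesis
      proof cases
        case 3
        have "finite (exits f S')" using S'(2) card.infinite by force
        then have "card (exits f' S') \<le> 1" using f'(6)[OF 3] S'(2) card_mono by metis
        moreover have "card (exits f' S') \<ge> 1"
          using forest_exits_card[OF X f'(1)] L(2) S'(1) by blast
        ultimately show ?thesis by simp
      qed (use f' S' in auto)
    qed
    then have "{S \<in> L. card (exits f' S) \<noteq> 1} \<subseteq> {S \<in> L. card (exits f S) \<noteq> 1} - {S}"
      using f'(3) by auto
    then have "{S \<in> L. card (exits f' S) \<noteq> 1} \<subset> {S \<in> L. card (exits f S) \<noteq> 1}"
      using S by blast
    then have "card {S \<in> L. card (exits f' S) \<noteq> 1} < card {S \<in> L. card (exits f S) \<noteq> 1}"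
      using fin by (intro psubset_card_mono) auto
    from less.hyps[OF this f'(1)] show ?thesis .
  qed
qed

section \<open>The primal-dual algorithm and complementary slackness\<close>

definition zero_set :: "('a \<times> 'a option) set \<Rightarrow> ('a \<Rightarrow> 'a option \<Rightarrow> real) \<Rightarrow> ('a \<times> 'a option) set" where
  "zero_set Op d = {(v, w) \<in> Op. d v w = 0}"

text \<open>A feasible dual solution \<open>y\<close> supported on \<open>L\<close>, with reduced costs \<open>d\<close>, in the
  primal-dual algorithm for minimum cost arborescences.\<close>

definition dual_state ::
  "'a set \<Rightarrow> ('a \<times> 'a option) set \<Rightarrow> ('a \<Rightarrow> 'a option \<Rightarrow> real) \<Rightarrow> 'a set set \<Rightarrow> ('a set \<Rightarrow> real)
    \<Rightarrow> ('a \<Rightarrow> 'a option \<Rightarrow> real) \<Rightarrow> bool" where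
  "dual_state V Op c L y d \<longleftrightarrow>
     (\<forall>(v, w)\<in>Op. d v w \<ge> 0 \<and>
        c v w = d v w + (\<Sum>S\<in>L. if v \<in> S \<and> w \<notin> Some ` S then y S else 0)) \<and>
     laminar L \<and>
     (\<forall>S\<in>L. S \<subseteq> V \<and> S \<noteq> {} \<and> y S > 0 \<and> tree_reroutable (zero_set Op d) L S \<and>
        (\<exists>(v, w)\<in>zero_set Op d. v \<in> S \<and> w \<notin> Some ` S) \<and>
        (\<forall>C. C \<subset> S \<and> C \<noteq> {} \<longrightarrow> (\<exists>(v, w)\<in>zero_set Op d. v \<in> C \<and> w \<in> Some ` (S - C))))"

text \<open>With \<open>Op\<close> the choices of zero reduced cost, a trap blocks every zero-cost
  forest, as neither an arc nor a root choice leads out; there the dual can be raised.\<close>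

definition trap :: "('a \<times> 'a option) set \<Rightarrow> 'a set \<Rightarrow> bool" where
  "trap Op S \<longleftrightarrow> S \<noteq> {} \<and> (\<forall>(v, w)\<in>Op. v \<in> S \<longrightarrow> w \<in> Some ` S)"

lemma minimal_trap:
  assumes "finite S" "trap Op S"
  obtains S' where "S' \<subseteq> S" "trap Op S'" "\<And>C. C \<subset> S' \<Longrightarrow> \<not> trap Op C"
  using assms
proof (induction "card S" arbitrary: S thesis rule: less_induct)
  case less
  show ?case
  proof (cases "\<exists>C. C \<subset> S \<and> trap Op C")
    case True
    then obtain C where C: "C \<subset> S" "trap Op C" by blast
    then have "card C < card S" "finite C" using less.prems(2)
      by (auto intro: psubset_card_mono finite_subset)
    then obtain S' where "S' \<subseteq> C" "trap Op S'" "\<And>C. C \<subset> S' \<Longrightarrow> \<not> trap Op C"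
      using less.hyps[of C] C by metis
    then show ?thesis using C less.prems(1)[of S'] by blast
  next
    case False
    then show ?thesis using less.prems by blast
  qed
qed

lemma tree_reroutable_mono:
  "tree_reroutable Op L S \<Longrightarrow> Op \<subseteq> Op' \<Longrightarrow> (\<And>S'. S' \<in> L' \<Longrightarrow> S' \<subseteq> S \<Longrightarrow> S' \<in> L)
    \<Longrightarrow> tree_reroutable Op' L' S"
proof -
  assume a: "tree_reroutable Op L S" "Op \<subseteq> Op'" "\<And>S'. S' \<in> L' \<Longrightarrow> S' \<subseteq> S \<Longrightarrow> S' \<in> L"
  have sub: "insert (e, None) (arcs_of Op) \<subseteq> insert (e, None) (arcs_of Op')" for e
    using a(2) by (auto simp: arcs_of_def)
  show ?thesis
    unfolding tree_reroutable_def
  proof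
    fix e assume "e \<in> S"
    then obtain g where g: "forest S (insert (e, None) (arcs_of Op)) g"
      "\<forall>S'\<in>L. S' \<subseteq> S \<longrightarrow> card (exits g S') = 1"
      using a(1) by (auto simp: tree_reroutable_def)
    show "\<exists>g. forest S (insert (e, None) (arcs_of Op')) g
      \<and> (\<forall>S'\<in>L'. S' \<subseteq> S \<longrightarrow> card (exits g S') = 1)"
      using forest_mono[OF g(1) sub] g(2) a(3) by (intro exI[of _ g]) simp
  qed
qed

text \<open>One dual ascent at an inclusion-minimal trap \<open>S\<close>. Minimality makes
  \<open>S\<close> strongly connected by zero arcs, which provides the in-trees. Raising
  \<open>y S\<close> to the least reduced cost leaving \<open>S\<close> keeps reduced costs
  nonnegative and frees a new choice; no zero choice is lost, because none left
  \<open>S\<close>.\<close>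

lemma dual_step:
  assumes V: "finite V" and Op: "finite Op" and f0: "forest V Op f0"
    and st: "dual_state V Op c L y d" and T: "trap (zero_set Op d) T" "T \<subseteq> V"
  shows "\<exists>L' y' d'. dual_state V Op c L' y' d' \<and> zero_set Op d \<subset> zero_set Op d'"
proof -
  let ?Z = "zero_set Op d"
  have "finite T" using T V finite_subset by blast
  then obtain S where ST: "S \<subseteq> T" and S: "trap ?Z S" and min: "\<And>C. C \<subset> S \<Longrightarrow> \<not> trap ?Z C"
    using minimal_trap[OF _ T(1)] by blast
  have SV: "S \<subseteq> V" "S \<noteq> {}" using ST T S by (auto simp: trap_def)
  have finS: "finite S" using SV(1) V finite_subset by blast
  have Sexit: "w \<in> Some ` S" if "(v, w) \<in> ?Z" "v \<in> S" for v w
    using S that by (auto simp: trap_def)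
  have conn: "\<exists>(v, w)\<in>?Z. v \<in> C \<and> w \<in> Some ` (S - C)" if C: "C \<subset> S" "C \<noteq> {}" for C
  proof -
    obtain v w where vw: "(v, w) \<in> ?Z" "v \<in> C" "w \<notin> Some ` C"
      using min[OF C(1)] C(2) by (auto simp: trap_def)
    then have "w \<in> Some ` S" using C Sexit by blast
    then have "w \<in> Some ` (S - C)" using vw(3) by auto
    then show ?thesis using vw by blast
  qed
  have dnn: "d v w \<ge> 0" if "(v, w) \<in> Op" for v w
    using st that by (auto simp: dual_state_def)
  have fL: "finite L"
  proof -
    have "L \<subseteq> Pow V" using st by (auto simp: dual_state_def)
    then show ?thesis using V finite_subset by auto
  qed
  \<comment> \<open>Every set already in \<open>L\<close> has a zero choice leaving it, so it is no
    trap; hence \<open>y'\<close> below overwrites no earlier dual value.\<close>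
  have SL: "S \<notin> L"
  proof
    assume "S \<in> L"
    then have "\<exists>(v, w)\<in>?Z. v \<in> S \<and> w \<notin> Some ` S"
      using st unfolding dual_state_def by blast
    then obtain v w where "(v, w) \<in> ?Z" "v \<in> S" "w \<notin> Some ` S" by blast
    then show False using Sexit by blast
  qed
  \<comment> \<open>A member of \<open>L\<close> meeting \<open>S\<close> but not inside it would,
    by its own strong connectivity, have a zero arc out of \<open>S\<close>.\<close>
  have lam: "S' \<subseteq> S" if S': "S' \<in> L" "S' \<inter> S \<noteq> {}" for S'
  proof (rule ccontr)
    assume "\<not> S' \<subseteq> S"
    then have "S' \<inter> S \<subset> S'" by blast
    then have "\<exists>(v, w)\<in>?Z. v \<in> S' \<inter> S \<and> w \<in> Some ` (S' - S' \<inter> S)"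
      using st S' unfolding dual_state_def by blast
    then obtain v w where "(v, w) \<in> ?Z" "v \<in> S" "w \<in> Some ` (S' - S' \<inter> S)" by blast
    then show False using Sexit[of v w] by auto
  qed
  define X where "X = {(v, w) \<in> Op. v \<in> S \<and> w \<notin> Some ` S}"
  have Xfin: "finite X" using Op by (auto simp: X_def intro: finite_subset)
  have Xne: "X \<noteq> {}"
  proof -
    obtain v where "v \<in> S" using SV by blast
    moreover obtain r where "leads f0 v r" using f0 SV \<open>v \<in> S\<close> by (auto simp: forest_def)
    ultimately have "exits f0 S \<noteq> {}" using exits_nonempty by metis
    then obtain u where "u \<in> S" "f0 u \<notin> Some ` S" by (auto simp: exits_def)
    then have "(u, f0 u) \<in> X" using f0 SV by (auto simp: X_def forest_def)
    then show ?thesis by blast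
  qed
  define \<delta> where "\<delta> = Min ((\<lambda>(v, w). d v w) ` X)"
  have \<delta>le: "\<delta> \<le> d v w" if "(v, w) \<in> X" for v w
    using that Xfin by (auto simp: \<delta>_def intro!: Min_le)
  have "\<delta> \<in> (\<lambda>(v, w). d v w) ` X" using Xfin Xne by (auto simp: \<delta>_def intro!: Min_in)
  then obtain v0 w0 where vw0: "(v0, w0) \<in> X" "\<delta> = d v0 w0" by auto
  have "d v0 w0 \<noteq> 0" using vw0 Sexit[of v0 w0] by (auto simp: X_def zero_set_def)
  then have \<delta>: "\<delta> > 0" using vw0 dnn[of v0 w0] by (auto simp: X_def)
  define d' where "d' = (\<lambda>v w. d v w - (if v \<in> S \<and> w \<notin> Some ` S then \<delta> else 0))"
  define y' where "y' = y(S := \<delta>)"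
  let ?Z' = "zero_set Op d'"
  have sub: "?Z \<subseteq> ?Z'"
  proof
    fix p assume p: "p \<in> ?Z"
    obtain v w where "p = (v, w)" by (cases p)
    then show "p \<in> ?Z'" using p Sexit[of v w] by (auto simp: zero_set_def d'_def)
  qed
  have vw0Z: "(v0, w0) \<in> ?Z'" using vw0 by (auto simp: zero_set_def d'_def X_def)
  have "(v0, w0) \<notin> ?Z" using \<open>d v0 w0 \<noteq> 0\<close> by (auto simp: zero_set_def)
  with vw0Z sub have psub: "?Z \<subset> ?Z'" by blast
  have cost: "d' v w \<ge> 0 \<and>
        c v w = d' v w + (\<Sum>S\<in>insert S L. if v \<in> S \<and> w \<notin> Some ` S then y' S else 0)"
    if vw: "(v, w) \<in> Op" for v w
  proof
    show "d' v w \<ge> 0" using vw dnn[OF vw] \<delta>le[of v w] by (auto simp: d'_def X_def)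
    have "(\<Sum>S\<in>L. if v \<in> S \<and> w \<notin> Some ` S then y' S else 0)
        = (\<Sum>S\<in>L. if v \<in> S \<and> w \<notin> Some ` S then y S else 0)"
      using SL by (intro sum.cong) (auto simp: y'_def)
    moreover have "c v w = d v w + (\<Sum>S\<in>L. if v \<in> S \<and> w \<notin> Some ` S then y S else 0)"
      using st vw by (auto simp: dual_state_def)
    ultimately show "c v w = d' v w + (\<Sum>S\<in>insert S L. if v \<in> S \<and> w \<notin> Some ` S then y' S else 0)"
      using fL SL by (simp add: d'_def y'_def)
  qed
  have lam': "laminar (insert S L)"
    using st lam unfolding laminar_def dual_state_def by blast
  have tree: "tree_reroutable ?Z (insert S L) S"
    unfolding tree_reroutable_def
  proof
    fix e assume e: "e \<in> S"
    let ?Op = "insert (e, None) (arcs_of ?Z)"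
    \<comment> \<open>Sets containing \<open>e\<close> escape by \<open>None\<close>, all others by
      strong connectivity. Growing from the empty set gives an in-tree to \<open>e\<close>, which is
      then repaired for the members of \<open>L\<close> inside \<open>S\<close>.\<close>
    have "\<exists>v\<in>C. \<exists>w. (v, w) \<in> ?Op \<and> w \<in> insert None (Some ` (S - C))"
      if C: "C \<subseteq> S - {}" "C \<noteq> {}" for C
    proof (cases "e \<in> C")
      case True
      then show ?thesis by blast
    next
      case False
      then have "C \<subset> S" using e C by blast
      from conn[OF this C(2)] obtain v w where "(v, w) \<in> ?Z" "v \<in> C" "w \<in> Some ` (S - C)"
        by blast
      moreover then have "(v, w) \<in> ?Op" by (auto simp: arcs_of_def)
      ultimately show ?thesis by blast
    qed
    moreover have "forest {} ?Op f0" by (simp add: forest_def fclosed_def)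
    ultimately obtain g0 where g0: "forest S ?Op g0"
      using extend_forest[OF finS, of "{}" ?Op f0] by blast
    have arcs: "arcs_of ?Op = arcs_of ?Z" by (auto simp: arcs_of_def)
    have "tree_reroutable ?Op {S'\<in>L. S' \<subseteq> S} S'" if "S' \<in> L" for S'
    proof -
      have "tree_reroutable ?Z L S'" using st that by (simp add: dual_state_def)
      then have "tree_reroutable ?Z {S'\<in>L. S' \<subseteq> S} S'" by (rule tree_reroutable_mono) auto
      then show ?thesis unfolding tree_reroutable_def arcs .
    qed
    then have "S' \<subseteq> S \<and> S' \<noteq> {} \<and> tree_reroutable ?Op {S'\<in>L. S' \<subseteq> S} S'"
      if "S' \<in> {S'\<in>L. S' \<subseteq> S}" for S'
      using st that by (auto simp: dual_state_def)
    moreover have "laminar {S'\<in>L. S' \<subseteq> S}" using lam' by (auto simp: laminar_def)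
    ultimately obtain g where g: "forest S ?Op g" "\<forall>S'\<in>{S'\<in>L. S' \<subseteq> S}. card (exits g S') = 1"
      using exists_single_exit_forest[OF finS g0, of "{S'\<in>L. S' \<subseteq> S}"] by blast
    have "g v \<in> Some ` S" if "v \<in> S" "v \<noteq> e" for v
    proof -
      have "(v, g v) \<in> ?Op" "g v \<in> insert None (Some ` S)"
        using g(1) that by (auto simp: forest_def fclosed_def)
      then show ?thesis using that by (auto simp: arcs_of_def)
    qed
    then have "exits g S \<subseteq> {e}" unfolding exits_def by blast
    then have "card (exits g S) \<le> 1" using card_mono[of "{e}"] by simp
    moreover have "card (exits g S) \<ge> 1" using forest_exits_card[OF finS g(1)] SV by blast
    ultimately have "card (exits g S) = 1" by simp
    then show "\<exists>g. forest S ?Op g \<and> (\<forall>S'\<in>insert S L. S' \<subseteq> S \<longrightarrow> card (exits g S') = 1)"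
      using g by (intro exI[of _ g]) auto
  qed
  have "S' \<subseteq> V \<and> S' \<noteq> {} \<and> y' S' > 0 \<and> tree_reroutable ?Z' (insert S L) S' \<and>
        (\<exists>(v, w)\<in>?Z'. v \<in> S' \<and> w \<notin> Some ` S') \<and>
        (\<forall>C. C \<subset> S' \<and> C \<noteq> {} \<longrightarrow> (\<exists>(v, w)\<in>?Z'. v \<in> C \<and> w \<in> Some ` (S' - C)))"
    if S': "S' \<in> insert S L" for S'
  proof (cases "S' = S")
    case True
    have "tree_reroutable ?Z' (insert S L) S" using tree_reroutable_mono[OF tree sub] by blast
    moreover have "\<exists>(v, w)\<in>?Z'. v \<in> S \<and> w \<notin> Some ` S" using vw0Z vw0 by (auto simp: X_def)
    moreover have "\<exists>(v, w)\<in>?Z'. v \<in> C \<and> w \<in> Some ` (S - C)" if "C \<subset> S" "C \<noteq> {}" for C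
      using conn[OF that] sub by blast
    ultimately show ?thesis using True SV \<delta> by (simp add: y'_def)
  next
    case False
    then have S'L: "S' \<in> L" using S' by blast
    \<comment> \<open>The new set lies inside no older one, so reroutability of the older sets
      acquires no new constraint.\<close>
    have "\<not> S \<subseteq> S'" using lam[OF S'L] False SV by blast
    then have "tree_reroutable ?Z' (insert S L) S'"
      using tree_reroutable_mono[of ?Z L S' ?Z' "insert S L"] sub st S'L by (auto simp: dual_state_def)
    moreover have "\<exists>(v, w)\<in>?Z'. v \<in> S' \<and> w \<notin> Some ` S'"
    proof -
      have "\<exists>(v, w)\<in>?Z. v \<in> S' \<and> w \<notin> Some ` S'" using st S'L by (simp add: dual_state_def)
      then show ?thesis using sub by blast
    qed
    moreover have "\<exists>(v, w)\<in>?Z'. v \<in> C \<and> w \<in> Some ` (S' - C)" if "C \<subset> S'" "C \<noteq> {}" for C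
    proof -
      have "\<exists>(v, w)\<in>?Z. v \<in> C \<and> w \<in> Some ` (S' - C)"
        using st S'L that by (simp add: dual_state_def)
      then show ?thesis using sub by blast
    qed
    ultimately show ?thesis using st S'L False by (auto simp: dual_state_def y'_def)
  qed
  then have "dual_state V Op c (insert S L) y' d'"
    unfolding dual_state_def using cost lam' by (intro conjI) auto
  then show ?thesis using psub by blast
qed

text \<open>Every ascent frees a further choice, so the number of choices with nonzero reduced cost
  decreases.\<close>

lemma dual_optimum:
  assumes V: "finite V" and Op: "finite Op" and f0: "forest V Op f0"
    and st: "dual_state V Op c L y d"
  shows "\<exists>L' y' d'. dual_state V Op c L' y' d' \<and> (\<forall>T\<subseteq>V. \<not> trap (zero_set Op d') T)"
  using st
proof (induction "card (Op - zero_set Op d)" arbitrary: L y d rule: less_induct)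
  case less
  show ?case
  proof (cases "\<forall>T\<subseteq>V. \<not> trap (zero_set Op d) T")
    case True
    then show ?thesis using less.prems by blast
  next
    case False
    then obtain T where "T \<subseteq> V" "trap (zero_set Op d) T" by blast
    then obtain L' y' d' where d': "dual_state V Op c L' y' d'" "zero_set Op d \<subset> zero_set Op d'"
      using dual_step[OF V Op f0 less.prems] by blast
    have "zero_set Op d' \<subseteq> Op" by (auto simp: zero_set_def)
    then have "Op - zero_set Op d' \<subset> Op - zero_set Op d" using d'(2) by blast
    then have "card (Op - zero_set Op d') < card (Op - zero_set Op d)"
      using Op by (intro psubset_card_mono) auto
    then show ?thesis using less.hyps d'(1) by blast
  qed
qed

text \<open>Each set of \<open>L\<close> is left at least once, so every forest costs at least the
  total dual value, with equality exactly under complementary slackness. The bound is attained: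
  without traps a forest of zero choices can be grown, and rerouting makes it leave every set
  once.\<close>

lemma optimal_forests_laminar_nonneg:
  fixes c :: "'a \<Rightarrow> 'a option \<Rightarrow> real"
  assumes V: "finite V" and OpV: "Op \<subseteq> V \<times> insert None (Some ` V)" and f0: "forest V Op f0"
    and c: "\<And>v w. (v, w) \<in> Op \<Longrightarrow> c v w \<ge> 0"
  shows "\<exists>L Z. laminar L \<and> (\<forall>S\<in>L. S \<subseteq> V \<and> S \<noteq> {}) \<and> Z \<subseteq> Op \<and>
    (\<forall>f. forest V Op f \<longrightarrow>
      ((\<forall>g. forest V Op g \<longrightarrow> (\<Sum>v\<in>V. c v (f v)) \<le> (\<Sum>v\<in>V. c v (g v))) \<longleftrightarrow>
       forest V Z f \<and> (\<forall>S\<in>L. card (exits f S) = 1)))"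
proof -
  have Op: "finite Op" by (rule finite_subset[OF OpV]) (use V in auto)
  have "dual_state V Op c {} (\<lambda>_. 0) c" using c by (auto simp: dual_state_def laminar_def)
  from dual_optimum[OF V Op f0 this] obtain L y d where st: "dual_state V Op c L y d"
    and nt: "\<And>T. T \<subseteq> V \<Longrightarrow> \<not> trap (zero_set Op d) T" by blast
  let ?Z = "zero_set Op d"
  have lam: "laminar L" and LV: "\<And>S. S \<in> L \<Longrightarrow> S \<subseteq> V \<and> S \<noteq> {} \<and> tree_reroutable ?Z L S \<and> y S > 0"
    using st by (auto simp: dual_state_def)
  have fL: "finite L"
  proof -
    have "L \<subseteq> Pow V" using LV by blast
    then show ?thesis using V finite_subset by auto
  qed
  have ZOp: "?Z \<subseteq> Op" by (auto simp: zero_set_def)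
  \<comment> \<open>Summing the dual decomposition of \<open>c\<close> over all vertices charges
    \<open>y S\<close> once for each exit of \<open>S\<close>.\<close>
  have cost: "(\<Sum>v\<in>V. c v (f v)) = (\<Sum>v\<in>V. d v (f v)) + (\<Sum>S\<in>L. y S * card (exits f S))"
    if f: "forest V Op f" for f
  proof -
    have "(\<Sum>v\<in>V. c v (f v))
        = (\<Sum>v\<in>V. d v (f v) + (\<Sum>S\<in>L. if v \<in> S \<and> f v \<notin> Some ` S then y S else 0))"
      using st f by (intro sum.cong) (auto simp: dual_state_def forest_def)
    also have "\<dots> = (\<Sum>v\<in>V. d v (f v))
        + (\<Sum>S\<in>L. \<Sum>v\<in>V. if v \<in> S \<and> f v \<notin> Some ` S then y S else 0)"
      using sum.swap[of "\<lambda>v S. if v \<in> S \<and> f v \<notin> Some ` S then y S else 0" L V]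
      by (simp add: sum.distrib)
    also have "(\<Sum>S\<in>L. \<Sum>v\<in>V. if v \<in> S \<and> f v \<notin> Some ` S then y S else 0)
        = (\<Sum>S\<in>L. y S * card (exits f S))"
    proof (rule sum.cong[OF refl])
      fix S assume "S \<in> L"
      then have "exits f S = {v \<in> V. v \<in> S \<and> f v \<notin> Some ` S}" using LV by (auto simp: exits_def)
      then show "(\<Sum>v\<in>V. if v \<in> S \<and> f v \<notin> Some ` S then y S else 0) = y S * card (exits f S)"
        using V by (simp add: sum.If_cases Int_def)
    qed
    finally show ?thesis .
  qed
  have dnn: "d v (f v) \<ge> 0" if "forest V Op f" "v \<in> V" for f v
    using st that by (auto simp: dual_state_def forest_def)
  have one: "card (exits f S) \<ge> 1" if "forest V Op f" "S \<in> L" for f S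
    using forest_exits_card[OF V that(1)] LV[OF that(2)] by blast
  have low: "(\<Sum>v\<in>V. c v (f v)) \<ge> sum y L" if f: "forest V Op f" for f
  proof -
    have "(\<Sum>v\<in>V. d v (f v)) \<ge> 0" using dnn[OF f] by (intro sum_nonneg) auto
    moreover have "(\<Sum>S\<in>L. y S * card (exits f S)) \<ge> sum y L"
    proof (rule sum_mono)
      fix S assume "S \<in> L"
      then have "y S > 0" "real (card (exits f S)) \<ge> 1" using LV one[OF f] by auto
      then show "y S \<le> y S * card (exits f S)" by simp
    qed
    ultimately show ?thesis using cost[OF f] by linarith
  qed
  have eq: "(\<Sum>v\<in>V. c v (f v)) = sum y L \<longleftrightarrow> forest V ?Z f \<and> (\<forall>S\<in>L. card (exits f S) = 1)"
    if f: "forest V Op f" for f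
  proof
    assume "forest V ?Z f \<and> (\<forall>S\<in>L. card (exits f S) = 1)"
    then have "\<forall>v\<in>V. d v (f v) = 0" "\<forall>S\<in>L. card (exits f S) = 1"
      by (auto simp: forest_def zero_set_def)
    then show "(\<Sum>v\<in>V. c v (f v)) = sum y L" using cost[OF f] by simp
  next
    assume e: "(\<Sum>v\<in>V. c v (f v)) = sum y L"
    have 1: "(\<Sum>v\<in>V. d v (f v)) \<ge> 0" using dnn[OF f] by (intro sum_nonneg) auto
    have nn: "y S * (real (card (exits f S)) - 1) \<ge> 0" if "S \<in> L" for S
      using one[OF f that] LV[OF that] by simp
    have 2: "(\<Sum>S\<in>L. y S * card (exits f S)) = sum y L + (\<Sum>S\<in>L. y S * (real (card (exits f S)) - 1))"
      by (simp add: algebra_simps sum_subtractf)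
    have 3: "(\<Sum>S\<in>L. y S * (real (card (exits f S)) - 1)) \<ge> 0" using nn by (intro sum_nonneg)
    have "(\<Sum>v\<in>V. d v (f v)) = 0" "(\<Sum>S\<in>L. y S * (real (card (exits f S)) - 1)) = 0"
      using e cost[OF f] 1 2 3 by linarith+
    then have "\<forall>v\<in>V. d v (f v) = 0" "\<forall>S\<in>L. y S * (real (card (exits f S)) - 1) = 0"
      using sum_nonneg_eq_0_iff[OF V, of "\<lambda>v. d v (f v)"] dnn[OF f]
        sum_nonneg_eq_0_iff[OF fL, of "\<lambda>S. y S * (real (card (exits f S)) - 1)"] nn by blast+
    moreover then have "\<forall>S\<in>L. card (exits f S) = 1" using LV by force
    ultimately show "forest V ?Z f \<and> (\<forall>S\<in>L. card (exits f S) = 1)"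
      using f by (auto simp: forest_def zero_set_def)
  qed
  have "\<exists>v\<in>C. \<exists>w. (v, w) \<in> ?Z \<and> w \<in> insert None (Some ` (V - C))" if C: "C \<subseteq> V - {}" "C \<noteq> {}" for C
  proof -
    obtain v w where vw: "(v, w) \<in> ?Z" "v \<in> C" "w \<notin> Some ` C"
      using nt[of C] C by (auto simp: trap_def)
    then have "w \<in> insert None (Some ` V)" using OpV ZOp by blast
    then have "w \<in> insert None (Some ` (V - C))" using vw(3) by auto
    then show ?thesis using vw by blast
  qed
  moreover have "forest {} ?Z f0" by (simp add: forest_def fclosed_def)
  ultimately obtain g0 where "forest V ?Z g0"
    using extend_forest[OF V, of "{}" ?Z f0] by blast
  then obtain g where g: "forest V ?Z g" "\<forall>S\<in>L. card (exits g S) = 1"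
    using exists_single_exit_forest[OF V _ lam] LV by metis
  then have g': "forest V Op g" using forest_mono ZOp by blast
  then have gm: "(\<Sum>v\<in>V. c v (g v)) = sum y L" using eq g by blast
  have "(\<forall>g. forest V Op g \<longrightarrow> (\<Sum>v\<in>V. c v (f v)) \<le> (\<Sum>v\<in>V. c v (g v)))
      \<longleftrightarrow> (\<Sum>v\<in>V. c v (f v)) = sum y L" if f: "forest V Op f" for f
    using gm g' low f by (metis order_antisym)
  then show ?thesis using eq lam LV ZOp by (intro exI[of _ L] exI[of _ ?Z]) auto
qed

text \<open>Each vertex makes exactly one choice, so subtracting a lower bound \<open>m\<close> from
  every cost shifts all forests by the same amount.\<close>

lemma optimal_forests_laminar:
  fixes c :: "'a \<Rightarrow> 'a option \<Rightarrow> real"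
  assumes V: "finite V" and OpV: "Op \<subseteq> V \<times> insert None (Some ` V)" and f0: "forest V Op f0"
  shows "\<exists>L Z. laminar L \<and> (\<forall>S\<in>L. S \<subseteq> V \<and> S \<noteq> {}) \<and> Z \<subseteq> Op \<and>
    (\<forall>f. forest V Op f \<longrightarrow>
      ((\<forall>g. forest V Op g \<longrightarrow> (\<Sum>v\<in>V. c v (f v)) \<le> (\<Sum>v\<in>V. c v (g v))) \<longleftrightarrow>
       forest V Z f \<and> (\<forall>S\<in>L. card (exits f S) = 1)))"
proof -
  have Op: "finite Op" by (rule finite_subset[OF OpV]) (use V in auto)
  define m where "m = Min (insert 0 ((\<lambda>(v, w). c v w) ` Op))"
  have "m \<le> c v w" if "(v, w) \<in> Op" for v w
    using that Op unfolding m_def by (intro Min_le) auto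
  then have "c v w - m \<ge> 0" if "(v, w) \<in> Op" for v w using that by fastforce
  from optimal_forests_laminar_nonneg[OF V OpV f0, of "\<lambda>v w. c v w - m", OF this]
  show ?thesis by (simp add: sum_subtractf)
qed

section \<open>Separating two vertices with a prescribed number of roots\<close>

lemma fclosed_Un: "fclosed f A \<Longrightarrow> fclosed f B \<Longrightarrow> fclosed f (A \<union> B)"
  by (auto simp: fclosed_def)

text \<open>Only the paths of \<open>x\<close> and \<open>y\<close> have to end; \<open>f\<close>
  may have cycles elsewhere. These two paths are kept, the rest is grown with roots restricted to
  \<open>R\<close>, and cutting at \<open>R\<close> makes all of \<open>R\<close> roots without
  rejoining \<open>x\<close> and \<open>y\<close>.\<close>

lemma separation_with_roots:
  assumes V: "finite V" and xy: "x \<in> V" "y \<in> V"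
    and f: "fclosed f V" "\<And>v. v \<in> V \<Longrightarrow> (v, f v) \<in> Op"
    and e: "leads f x e1" "leads f y e2" "e1 \<noteq> e2" "e1 \<in> R" "e2 \<in> R"
    and R: "R \<subseteq> V" "\<And>v. v \<in> R \<Longrightarrow> (v, None) \<in> Op"
    and nt: "\<And>C. C \<subseteq> V \<Longrightarrow> C \<noteq> {} \<Longrightarrow> C \<inter> R \<noteq> {} \<or> (\<exists>v\<in>C. \<exists>u\<in>V - C. (v, Some u) \<in> Op)"
  shows "\<exists>g. forest V Op g \<and> roots V g = R \<and> (\<forall>r. \<not> (leads g x r \<and> leads g y r))"
proof -
  define D where "D = orbit f x \<union> orbit f y"
  define Op' where "Op' = {(v, w) \<in> Op. w = None \<longrightarrow> v \<in> R}"
  have DV: "D \<subseteq> V" using orbit_subset[OF f(1)] xy by (auto simp: D_def)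
  have Dc: "fclosed f D" unfolding D_def by (intro fclosed_Un fclosed_orbit)
  have lD: "leads f v e1 \<or> leads f v e2" if "v \<in> D" for v
    using that orbit_leads[OF e(1), of v] orbit_leads[OF e(2), of v] by (auto simp: D_def)
  have "(v, f v) \<in> Op'" if v: "v \<in> D" for v
  proof -
    have "v \<in> R" if "f v = None"
      using lD[OF v] leads_unique leads_root[of f v, OF that] e by metis
    then show ?thesis using v f(2) DV by (auto simp: Op'_def)
  qed
  then have fD: "forest D Op' f" using Dc lD by (auto simp: forest_def)
  have "\<exists>v\<in>C. \<exists>w. (v, w) \<in> Op' \<and> w \<in> insert None (Some ` (V - C))"
    if C: "C \<subseteq> V - D" "C \<noteq> {}" for C
  proof -
    from nt[of C] C consider "C \<inter> R \<noteq> {}" | "\<exists>v\<in>C. \<exists>u\<in>V - C. (v, Some u) \<in> Op" by blast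
    then show ?thesis
    proof cases
      case 1
      then obtain v where "v \<in> C" "v \<in> R" by blast
      then have "(v, None) \<in> Op'" using R by (simp add: Op'_def)
      then show ?thesis using \<open>v \<in> C\<close> by blast
    next
      case 2
      then obtain v u where "v \<in> C" "u \<in> V - C" "(v, Some u) \<in> Op" by blast
      then have "(v, Some u) \<in> Op'" by (simp add: Op'_def)
      then show ?thesis using \<open>v \<in> C\<close> \<open>u \<in> V - C\<close> by blast
    qed
  qed
  from extend_forest[OF V DV fD this] obtain g where g: "forest V Op' g" "\<forall>v\<in>D. g v = f v" by blast
  have gR: "roots V g \<subseteq> R" using g(1) by (auto simp: roots_def forest_def Op'_def)
  have gl: "leads g x e1" "leads g y e2"
    using leads_cong_on[OF _ Dc] e g(2) orbit_self[of x f] orbit_self[of y f] by (auto simp: D_def)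
  let ?h = "mix R (\<lambda>_. None) g"
  have "forest V Op g" by (rule forest_mono[OF g(1)]) (auto simp: Op'_def)
  then have "forest V Op ?h" using forest_cut R(2) by blast
  moreover have "roots V ?h = R" using gR R(1) by (auto simp: roots_def mix_def)
  moreover have "\<not> (leads ?h x r \<and> leads ?h y r)" for r
    using leads_cut[OF gl(1)] leads_cut[OF gl(2)] e(3) leads_unique by metis
  ultimately show ?thesis by blast
qed

text \<open>Following \<open>F\<close> or \<open>G\<close>, the vertex \<open>x\<close> can be sent both to \<open>t\<close> and, through \<open>z\<close>, to \<open>q\<close>,
  while \<open>y\<close> keeps its root \<open>s\<close>; one of the two choices separates \<open>x\<close> from \<open>y\<close>. If \<open>s\<close> is
  not a root of \<open>G\<close> then it has to replace one of them. When no root \<open>u\<close> of \<open>G\<close> is replaceable,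
  there are disjoint closed sets around all of them, each containing a root of \<open>F\<close> other than
  \<open>s\<close>, so \<open>F\<close> has more roots than \<open>G\<close>.\<close>

lemma mixed_separation:
  assumes V: "finite V" and F: "forest V Op F" and G: "forest V Op G"
    and k: "card (roots V F) = card (roots V G)"
    and xy: "x \<in> V" "y \<in> V" and z: "F x = Some z" and av: "x \<notin> orbit F y"
    and t: "leads G x t" "leads G y t" and q: "leads G z q" "q \<noteq> t"
  shows "\<exists>g. forest V Op g \<and> card (roots V g) = card (roots V F)
    \<and> (\<forall>r. \<not> (leads g x r \<and> leads g y r))"
proof -
  have Fc: "fclosed F V" and Gc: "fclosed G V" using F G by (auto simp: forest_def)
  have FO: "(v, F v) \<in> Op" and GO: "(v, G v) \<in> Op" if "v \<in> V" for v
    using F G that by (auto simp: forest_def)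
  have zV: "z \<in> V" using Fc xy z by (force simp: fclosed_def)
  define P where "P = orbit G z"
  define P' where "P' = orbit G x"
  define B where "B = orbit F y"
  define D where "D = P \<union> P'"
  have cl: "fclosed G P" "fclosed G P'" "fclosed F B"
    by (auto simp: P_def P'_def B_def fclosed_orbit)
  then have Dc: "fclosed G D" unfolding D_def by (intro fclosed_Un)
  have DV: "D \<subseteq> V" using orbit_subset[OF Gc] zV xy by (auto simp: D_def P_def P'_def)
  have lP: "leads G v q" if "v \<in> P" for v using that q(1) orbit_leads by (simp add: P_def)
  have lP': "leads G v t" if "v \<in> P'" for v using that t(1) orbit_leads by (simp add: P'_def)
  have PP': "P \<inter> P' = {}"
  proof (rule ccontr)
    assume "P \<inter> P' \<noteq> {}"
    then obtain v where "v \<in> P" "v \<in> P'" by blast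
    then show False using leads_unique[OF lP lP'] q(2) by blast
  qed
  have mem: "x \<in> P'" "z \<in> P" "y \<in> B" "x \<notin> B"
    using orbit_self av by (auto simp: P_def P'_def B_def)
  then have xP: "x \<notin> P" and "y \<noteq> x" using PP' by auto
  \<comment> \<open>\<open>f1\<close> sends \<open>x\<close> along \<open>G\<close> to
    \<open>t\<close>. The later \<open>f3\<close> differs only at \<open>x\<close>, which it sends
    along \<open>F\<close> to \<open>z\<close> and on to \<open>q\<close>; only its paths from
    \<open>x\<close> and \<open>y\<close> matter.\<close>
  define f1 where "f1 = mix D G F"
  have f1: "forest V Op f1" unfolding f1_def by (rule forest_mix[OF F G Dc DV])
  have f1D: "f1 v = G v" if "v \<in> D" for v using that by (simp add: f1_def mix_def)
  have f1n: "f1 v = F v" if "v \<notin> D" for v using that by (simp add: f1_def mix_def)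
  have f1x: "leads f1 x t"
    using leads_cong_on[OF t(1) Dc, of f1] f1D mem by (auto simp: D_def)
  obtain s where s: "leads f1 y s" using f1 xy by (auto simp: forest_def)
  define f3 where "f3 = f1(x := Some z)"
  \<comment> \<open>A closed set containing \<open>y\<close> but not \<open>x\<close>, on which
    \<open>f1\<close> and \<open>f3\<close> agree, so \<open>y\<close> ends at \<open>s\<close>
    under both. The \<open>F\<close>-path of \<open>y\<close> avoids \<open>x\<close> by
    \<open>av\<close>, and no \<open>G\<close>-path in \<open>D\<close> returns to
    \<open>x\<close>.\<close>
  define Y where "Y = (B \<union> D) - {x}"
  have Yc: "fclosed f1 Y"
    unfolding fclosed_def
  proof
    fix v assume v: "v \<in> Y"
    show "f1 v \<in> insert None (Some ` Y)"
    proof (cases "v \<in> D")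
      case True
      show ?thesis
      proof (cases "G v")
        case (Some u)
        have "u \<in> D" using Dc True Some by (force simp: fclosed_def)
        moreover have "u \<noteq> x"
        proof
          assume ux: "u = x"
          have "v \<in> P'"
          proof (rule ccontr)
            assume "v \<notin> P'"
            then have "v \<in> P" using True by (simp add: D_def)
            then have "x \<in> P" using cl(1) Some ux by (force simp: fclosed_def)
            then show False using xP by blast
          qed
          moreover have "x \<in> orbit G v" using Some ux by (auto simp: orbit_def)
          ultimately have "x = v" using orbit_antisym[OF t(1)] by (simp add: P'_def)
          then show False using v by (simp add: Y_def)
        qed
        ultimately show ?thesis using Some f1D[OF True] by (auto simp: Y_def)
      qed (use f1D[OF True] in simp)
    next
      case False
      then have "v \<in> B" using v by (auto simp: Y_def)
      then have "F v \<in> insert None (Some ` (B - {x}))" using cl(3) mem(4) by (simp add: fclosed_def)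
      then show ?thesis using f1n[OF False] by (auto simp: Y_def)
    qed
  qed
  have yY: "y \<in> Y" using mem \<open>y \<noteq> x\<close> by (auto simp: Y_def)
  have f3y: "leads f3 y s"
    using leads_cong_on[OF s Yc yY, of f3] by (simp add: f3_def Y_def)
  have "\<forall>u\<in>P. f3 u = G u" using f1D xP by (auto simp: f3_def D_def)
  then have "leads f3 z q" using leads_cong_on[OF q(1) cl(1) mem(2)] by blast
  then have f3x: "leads f3 x q" using leads_step[of f3 x z q] by (simp add: f3_def)
  have f1c: "fclosed f1 V" "\<And>v. v \<in> V \<Longrightarrow> (v, f1 v) \<in> Op" using f1 by (auto simp: forest_def)
  have f3c: "fclosed f3 V" using f1c zV by (auto simp: f3_def fclosed_def)
  have f3O: "(v, f3 v) \<in> Op" if "v \<in> V" for v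
    using f1c(2)[OF that] FO[OF xy(1)] z by (auto simp: f3_def)
  define RG where "RG = roots V G"
  have RGV: "RG \<subseteq> V" by (auto simp: RG_def roots_def)
  have RGO: "(v, None) \<in> Op" if "v \<in> RG" for v
    using that GO[of v] by (auto simp: RG_def roots_def)
  have tq: "t \<in> RG" "q \<in> RG"
    using leads_None[OF t(1)] leads_None[OF q(1)] leads_fclosed[OF t(1) Gc] leads_fclosed[OF q(1) Gc] xy zV
    by (auto simp: RG_def roots_def)
  have ntG: "C \<inter> RG \<noteq> {} \<or> (\<exists>v\<in>C. \<exists>u\<in>V - C. (v, Some u) \<in> Op)" if C: "C \<subseteq> V" "C \<noteq> {}" for C
  proof -
    obtain v where v: "v \<in> C" using C by blast
    then obtain r where "leads G v r" using G C by (auto simp: forest_def)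
    then have "exits G C \<noteq> {}" using v exits_nonempty by metis
    then obtain u where u: "u \<in> C" "G u \<notin> Some ` C" by (auto simp: exits_def)
    show ?thesis
    proof (cases "G u")
      case None
      then show ?thesis using u C by (auto simp: RG_def roots_def)
    next
      case (Some w)
      then have "w \<in> V - C" using u Gc C by (force simp: fclosed_def)
      moreover have "(u, Some w) \<in> Op" using GO[of u] u C Some by auto
      ultimately show ?thesis using u by blast
    qed
  qed
  have sV: "s \<in> V" using leads_fclosed[OF s f1c(1)] xy by blast
  have f1s: "f1 s = None" using leads_None[OF s] .
  show ?thesis
  proof (cases "s \<in> RG")
    \<comment> \<open>With root set \<open>RG\<close> the root number is right, and one of the ends
      \<open>t\<close>, \<open>q\<close> available to \<open>x\<close> differs from
      \<open>s\<close>.\<close>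
    case True
    show ?thesis
    proof (cases "s = t")
      case True
      then have "q \<noteq> s" using q by simp
      from separation_with_roots[OF V xy f3c f3O f3x f3y this tq(2) \<open>s \<in> RG\<close> RGV RGO ntG]
      show ?thesis using k by (auto simp: RG_def)
    next
      case False
      then have "t \<noteq> s" by simp
      from separation_with_roots[OF V xy f1c f1x s this tq(1) \<open>s \<in> RG\<close> RGV RGO ntG]
      show ?thesis using k by (auto simp: RG_def)
    qed
  next
    case sRG: False
    have "s \<notin> D"
    proof
      assume sD: "s \<in> D"
      then have "G s = None" using f1s f1D by simp
      then have "s \<in> RG" using sV by (simp add: RG_def roots_def)
      then show False using sRG by blast
    qed
    then have Fs: "F s = None" using f1s f1n by simp
    have finRG: "finite RG" using RGV V finite_subset by blast
    \<comment> \<open>Now \<open>s\<close> is a root of \<open>F\<close> outside \<open>RG\<close>,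
      and trading it for one root \<open>u\<close> of \<open>G\<close> keeps the number.
      \<open>open_at u\<close> is the growth condition for the root set \<open>R u\<close>.\<close>
    define R where "R u = insert s (RG - {u})" for u
    have RV: "R u \<subseteq> V" for u using RGV sV by (auto simp: R_def)
    have RO: "(v, None) \<in> Op" if "v \<in> R u" for u v
      using that RGO FO[OF sV] Fs by (auto simp: R_def)
    have Rcard: "card (R u) = card RG" if "u \<in> RG" for u
      using that sRG finRG card_Suc_Diff1[OF finRG that] by (simp add: R_def)
    define open_at where "open_at u C \<longleftrightarrow> C \<inter> R u \<noteq> {} \<or> (\<exists>v\<in>C. \<exists>w\<in>V - C. (v, Some w) \<in> Op)"
      for u C
    have "\<exists>u\<in>RG. \<forall>C. C \<subseteq> V \<longrightarrow> C \<noteq> {} \<longrightarrow> open_at u C"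
    proof (rule ccontr)
      assume "\<not> ?thesis"
      then have "\<forall>u\<in>RG. \<exists>C. C \<subseteq> V \<and> C \<noteq> {} \<and> \<not> open_at u C" by blast
      from bchoice[OF this] obtain C
        where CC: "\<forall>u\<in>RG. C u \<subseteq> V \<and> C u \<noteq> {} \<and> \<not> open_at u (C u)" by blast
      then have C: "\<And>u. u \<in> RG \<Longrightarrow> C u \<subseteq> V" "\<And>u. u \<in> RG \<Longrightarrow> C u \<noteq> {}"
        "\<And>u. u \<in> RG \<Longrightarrow> C u \<inter> R u = {}"
        "\<And>u v w. u \<in> RG \<Longrightarrow> v \<in> C u \<Longrightarrow> w \<in> V - C u \<Longrightarrow> (v, Some w) \<notin> Op"
        unfolding open_at_def by blast+
      have closed: "fclosed h (C u)" if u: "u \<in> RG" and h: "forest V Op h" for u h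
        unfolding fclosed_def
      proof
        fix v assume v: "v \<in> C u"
        then have "v \<in> V" using C(1) u by blast
        then have "(v, h v) \<in> Op" "h v \<in> insert None (Some ` V)"
          using h by (auto simp: forest_def fclosed_def)
        then show "h v \<in> insert None (Some ` C u)" using C(4)[OF u v] by (cases "h v") auto
      qed
      have root: "\<exists>r\<in>C u. h r = None \<and> leads h v r"
        if u: "u \<in> RG" and h: "forest V Op h" and v: "v \<in> C u" for u h v
      proof -
        have "v \<in> V" using C(1) u v by blast
        then obtain r where r: "leads h v r" using h unfolding forest_def by blast
        then show ?thesis using leads_fclosed[OF r closed[OF u h] v] leads_None[OF r] by blast
      qed
      \<comment> \<open>All roots of \<open>G\<close> other than \<open>u\<close> lie in
        \<open>R u\<close>, which misses \<open>C u\<close>; so \<open>G\<close>-paths from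
        \<open>C u\<close> end at \<open>u\<close>, and the sets for different \<open>u\<close> are
        disjoint.\<close>
      have Gu: "leads G v u" if u: "u \<in> RG" and v: "v \<in> C u" for u v
      proof -
        obtain r where r: "r \<in> C u" "G r = None" "leads G v r" using root[OF u G v] by blast
        then have "r \<in> RG" using C(1) u by (auto simp: RG_def roots_def)
        then have "r = u" using r C(3)[OF u] by (auto simp: R_def)
        then show ?thesis using r by simp
      qed
      have "\<forall>u\<in>RG. \<exists>r\<in>C u. F r = None" using root[OF _ F] C(2) by blast
      then obtain \<rho> where \<rho>: "\<And>u. u \<in> RG \<Longrightarrow> \<rho> u \<in> C u" "\<And>u. u \<in> RG \<Longrightarrow> F (\<rho> u) = None" by metis
      have "inj_on \<rho> RG"
      proof (rule inj_onI)
        fix u u' assume u: "u \<in> RG" "u' \<in> RG" "\<rho> u = \<rho> u'"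
        then have "leads G (\<rho> u) u" "leads G (\<rho> u) u'" using Gu \<rho>(1) by metis+
        then show "u = u'" by (rule leads_unique)
      qed
      moreover have "\<rho> ` RG \<subseteq> roots V F - {s}"
      proof
        fix v assume "v \<in> \<rho> ` RG"
        then obtain u where u: "u \<in> RG" "v = \<rho> u" by blast
        have "\<rho> u \<noteq> s" using \<rho>(1)[OF u(1)] C(3)[OF u(1)] by (auto simp: R_def)
        then show "v \<in> roots V F - {s}" using u \<rho> C(1) by (auto simp: roots_def)
      qed
      moreover have fin: "finite (roots V F)" using V by (simp add: roots_def)
      ultimately have "card RG \<le> card (roots V F - {s})" by (intro card_inj_on_le) auto
      moreover have "s \<in> roots V F" using sV Fs by (simp add: roots_def)
      ultimately have "card RG < card (roots V F)"
        using fin by (metis card_Diff1_less order_le_less_trans)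
      then show False using k by (simp add: RG_def)
    qed
    then obtain u where u: "u \<in> RG" and nt: "\<And>C. C \<subseteq> V \<Longrightarrow> C \<noteq> {} \<Longrightarrow> open_at u C" by blast
    note nt = nt[unfolded open_at_def]
    have sR: "s \<in> R u" by (simp add: R_def)
    have ne: "q \<noteq> s" "t \<noteq> s" using tq sRG by auto
    show ?thesis
    proof (cases "u = t")
      case True
      then have "q \<in> R u" using tq q by (simp add: R_def)
      from separation_with_roots[OF V xy f3c f3O f3x f3y ne(1) this sR RV RO[of _ u] nt]
      show ?thesis using k Rcard[OF u] by (auto simp: RG_def)
    next
      case False
      then have "t \<in> R u" using tq by (simp add: R_def)
      from separation_with_roots[OF V xy f1c f1x s ne(2) this sR RV RO[of _ u] nt]
      show ?thesis using k Rcard[OF u] by (auto simp: RG_def)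
    qed
  qed
qed

section \<open>Contracting classes\<close>

text \<open>The axioms retain all that is needed of the weights: membership in \<open>Om\<close> can
  be checked class by class once the glued function is a forest. \<open>UNIV\<close> in
  \<open>Om_mix\<close> asks only for closure and termination, the choices themselves coming from
  members of \<open>Om\<close>.\<close>

locale class_mixing =
  fixes V :: "'a set" and P :: "'a set set" and Om :: "('a \<Rightarrow> 'a option) set"
  assumes finV: "finite V"
    and P_sub: "C \<in> P \<Longrightarrow> C \<subseteq> V"
    and P_ex1: "v \<in> V \<Longrightarrow> \<exists>!C. C \<in> P \<and> v \<in> C"
    and Om_forest: "f \<in> Om \<Longrightarrow> forest V UNIV f"
    and Om_exit: "f \<in> Om \<Longrightarrow> C \<in> P \<Longrightarrow> card (exits f C) = 1"
    and Om_mix: "forest V UNIV h \<Longrightarrow> (\<And>C. C \<in> P \<Longrightarrow> \<exists>f\<in>Om. \<forall>v\<in>C. h v = f v) \<Longrightarrow> h \<in> Om"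
begin

definition cl :: "'a \<Rightarrow> 'a set" where
  "cl v = (THE C. C \<in> P \<and> v \<in> C)"

definition exit_of :: "('a \<Rightarrow> 'a option) \<Rightarrow> 'a set \<Rightarrow> 'a" where
  "exit_of f C = (THE e. e \<in> exits f C)"

text \<open>The contraction of \<open>f\<close>, meaningful for members of \<open>Om\<close> because
  they have one exit per class.\<close>

definition quot :: "('a \<Rightarrow> 'a option) \<Rightarrow> 'a set \<Rightarrow> 'a set option" where
  "quot f C = map_option cl (f (exit_of f C))"

text \<open>Choices realised by different members of \<open>Om\<close> may be combined here;
  \<open>quot_lift\<close> brings forests made of them back to a single member.\<close>

definition quot_choices :: "('a set \<times> 'a set option) set" where
  "quot_choices = {(C, quot f C) | C f. C \<in> P \<and> f \<in> Om}"

lemma cl: "v \<in> V \<Longrightarrow> cl v \<in> P \<and> v \<in> cl v"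
  unfolding cl_def using theI'[OF P_ex1] by blast

lemma cl_eq: "C \<in> P \<Longrightarrow> v \<in> C \<Longrightarrow> cl v = C"
  using cl P_ex1 P_sub by (metis subsetD)

lemma exits_eq: "f \<in> Om \<Longrightarrow> C \<in> P \<Longrightarrow> exits f C = {exit_of f C}"
  unfolding exit_of_def using Om_exit by (metis card_1_singletonE singletonD singletonI the_equality)

lemma exit_of: "f \<in> Om \<Longrightarrow> C \<in> P \<Longrightarrow> exit_of f C \<in> C \<and> f (exit_of f C) \<notin> Some ` C"
  using exits_eq[of f C] by (auto simp: exits_def)

lemma exit_eq: "f \<in> Om \<Longrightarrow> C \<in> P \<Longrightarrow> v \<in> C \<Longrightarrow> f v \<notin> Some ` C \<Longrightarrow> v = exit_of f C"
  using exits_eq[of f C] by (auto simp: exits_def)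

lemma succ_in: "f \<in> Om \<Longrightarrow> v \<in> V \<Longrightarrow> f v = Some u \<Longrightarrow> u \<in> V"
  using Om_forest[of f] by (force simp: forest_def fclosed_def)

text \<open>A path leaves a class only at its unique exit, so it visits the classes in the order
  given by \<open>quot f\<close>.\<close>

lemma leads_quot: "f \<in> Om \<Longrightarrow> v \<in> V \<Longrightarrow> leads f v r \<Longrightarrow> leads (quot f) (cl v) (cl r)"
proof -
  assume f: "f \<in> Om" and "v \<in> V" "leads f v r"
  from this(3,2) show ?thesis
  proof (induction rule: leads.induct)
    case (leads_root v)
    have "v = exit_of f (cl v)" using leads_root cl f by (intro exit_eq) auto
    then have "quot f (cl v) = None" using leads_root by (simp add: quot_def)
    then show ?case by (rule leads.leads_root)
  next
    case (leads_step v u r)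
    have u: "u \<in> V" using succ_in[OF f] leads_step by blast
    show ?case
    proof (cases "u \<in> cl v")
      case True
      then have "cl u = cl v" using cl_eq cl leads_step.prems by blast
      then show ?thesis using leads_step.IH[OF u] by simp
    next
      case False
      then have "f v \<notin> Some ` cl v" using leads_step.hyps(1) by auto
      then have "v = exit_of f (cl v)" using exit_eq f cl leads_step.prems by blast
      then have "quot f (cl v) = Some (cl u)" using leads_step.hyps(1) by (simp add: quot_def)
      then show ?thesis using leads_step.IH[OF u] leads.leads_step by metis
    qed
  qed
qed

lemma root_exit: "f \<in> Om \<Longrightarrow> r \<in> V \<Longrightarrow> f r = None \<Longrightarrow> r = exit_of f (cl r)"
  using cl by (intro exit_eq) auto

text \<open>For the converse, a root is the exit of its class, so two roots in the same class
  coincide.\<close>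

lemma leads_iff_quot:
  assumes "f \<in> Om" "x \<in> V" "y \<in> V"
  shows "(\<exists>r. leads f x r \<and> leads f y r) \<longleftrightarrow>
    (\<exists>R. leads (quot f) (cl x) R \<and> leads (quot f) (cl y) R)"
proof
  assume "\<exists>r. leads f x r \<and> leads f y r"
  then show "\<exists>R. leads (quot f) (cl x) R \<and> leads (quot f) (cl y) R"
    using leads_quot assms by blast
next
  assume "\<exists>R. leads (quot f) (cl x) R \<and> leads (quot f) (cl y) R"
  then obtain R where R: "leads (quot f) (cl x) R" "leads (quot f) (cl y) R" by blast
  have f: "forest V UNIV f" using Om_forest assms by blast
  obtain r where r: "r \<in> roots V f" "leads f x r" using forest_leads[OF f assms(2)] by blast
  obtain s where s: "s \<in> roots V f" "leads f y s" using forest_leads[OF f assms(3)] by blast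
  have "cl r = R" "cl s = R"
    using leads_quot[OF assms(1)] assms r s R leads_unique by metis+
  moreover have "r = exit_of f (cl r)" "s = exit_of f (cl s)"
    using root_exit[OF assms(1)] r s by (auto simp: roots_def)
  ultimately have "r = s" by simp
  then show "\<exists>r. leads f x r \<and> leads f y r" using r s by blast
qed

lemma same_class_together:
  assumes "f \<in> Om" "C \<in> P" "x \<in> C" "y \<in> C"
  shows "\<exists>r. leads f x r \<and> leads f y r"
proof -
  have xy: "x \<in> V" "y \<in> V" using assms P_sub by auto
  obtain r where "leads f x r" using forest_leads[OF Om_forest[OF assms(1)] xy(1)] by blast
  then have "leads (quot f) (cl x) (cl r)" using leads_quot assms xy by blast
  moreover have "cl x = cl y" using cl_eq assms by simp
  ultimately show ?thesis using leads_iff_quot[OF assms(1) xy] by auto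
qed

lemma finite_P: "finite P"
proof -
  have "P \<subseteq> Pow V" using P_sub by blast
  then show ?thesis using finV finite_subset by auto
qed

lemma quot_forest:
  assumes f: "f \<in> Om"
  shows "forest P quot_choices (quot f)"
proof -
  have "quot f C \<in> insert None (Some ` P) \<and> (C, quot f C) \<in> quot_choices
      \<and> (\<exists>R. leads (quot f) C R)" if C: "C \<in> P" for C
  proof -
    have e: "exit_of f C \<in> C" "exit_of f C \<in> V" using exit_of f C P_sub by blast+
    obtain r where "leads f (exit_of f C) r" using forest_leads[OF Om_forest[OF f] e(2)] by blast
    then have "leads (quot f) C (cl r)" using leads_quot[OF f e(2)] cl_eq[OF C e(1)] by simp
    moreover have "quot f C \<in> insert None (Some ` P)"
      using succ_in[OF f e(2)] cl by (cases "f (exit_of f C)") (auto simp: quot_def)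
    ultimately show ?thesis using f C by (auto simp: quot_choices_def)
  qed
  then show ?thesis by (auto simp: forest_def fclosed_def)
qed

lemma quot_roots:
  assumes f: "f \<in> Om"
  shows "card (roots P (quot f)) = card (roots V f)"
proof -
  have "bij_betw cl (roots V f) (roots P (quot f))"
    unfolding bij_betw_def
  proof
    show "inj_on cl (roots V f)"
      using root_exit[OF f] by (intro inj_onI) (metis (mono_tags, lifting) roots_def mem_Collect_eq)
    show "cl ` roots V f = roots P (quot f)"
    proof
      show "cl ` roots V f \<subseteq> roots P (quot f)"
      proof
        fix C assume "C \<in> cl ` roots V f"
        then obtain r where r: "r \<in> V" "f r = None" "C = cl r" by (auto simp: roots_def)
        then have "quot f C = None" using root_exit[OF f r(1,2)] by (simp add: quot_def)
        then show "C \<in> roots P (quot f)" using cl r by (simp add: roots_def)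
      qed
      show "roots P (quot f) \<subseteq> cl ` roots V f"
      proof
        fix C assume "C \<in> roots P (quot f)"
        then have C: "C \<in> P" "f (exit_of f C) = None" by (auto simp: roots_def quot_def)
        have "exit_of f C \<in> C" using exit_of f C by blast
        then have "exit_of f C \<in> roots V f" "cl (exit_of f C) = C"
          using C P_sub cl_eq by (auto simp: roots_def)
        then show "C \<in> cl ` roots V f" by blast
      qed
    qed
  qed
  then show ?thesis by (simp add: bij_betw_same_card)
qed

text \<open>On each class \<open>C\<close> a member \<open>s C\<close> of \<open>Om\<close>
  realising \<open>h C\<close> is copied. Paths in \<open>C\<close> follow \<open>s C\<close> to its
  exit and then continue along \<open>h\<close>, so termination of \<open>h\<close> carries over to
  the glued function.\<close>

lemma quot_lift:
  assumes h: "forest P quot_choices h"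
  shows "\<exists>f\<in>Om. \<forall>C\<in>P. quot f C = h C"
proof -
  have "\<forall>C\<in>P. \<exists>f\<in>Om. quot f C = h C"
    using h by (force simp: forest_def quot_choices_def)
  then obtain s where s: "\<And>C. C \<in> P \<Longrightarrow> s C \<in> Om" "\<And>C. C \<in> P \<Longrightarrow> quot (s C) C = h C" by metis
  define f where "f = (\<lambda>v. s (cl v) v)"
  have fC: "f v = s C v" if "C \<in> P" "v \<in> C" for C v using cl_eq that by (simp add: f_def)
  have inner: "\<exists>r. leads f v r" if C: "C \<in> P" "v \<in> C" and e: "\<exists>r. leads f (exit_of (s C) C) r" for C v
  proof -
    have "v \<in> V" using C P_sub by blast
    then obtain r where "leads (s C) v r" using forest_leads[OF Om_forest[OF s(1)[OF C(1)]]] by blast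
    then show ?thesis using C(2)
    proof (induction rule: leads.induct)
      case (leads_root v)
      then have "v = exit_of (s C) C" using C by (intro exit_eq s) auto
      then show ?case using e by simp
    next
      case (leads_step v u r)
      show ?case
      proof (cases "u \<in> C")
        case True
        then show ?thesis using leads_step fC[OF C(1)] leads.leads_step by metis
      next
        case False
        then have "v = exit_of (s C) C" using C leads_step by (intro exit_eq s) auto
        then show ?thesis using e by simp
      qed
    qed
  qed
  have fV: "u \<in> V" if "v \<in> V" "f v = Some u" for u v
    using succ_in[OF s(1)] that cl by (auto simp: f_def)
  have exit: "\<exists>r. leads f (exit_of (s C) C) r" if "leads h C R" "C \<in> P" for C R
    using that
  proof (induction rule: leads.induct)
    case (leads_root C)
    then have "s C (exit_of (s C) C) = None" using s(2)[of C] by (simp add: quot_def)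
    then have "f (exit_of (s C) C) = None" using fC exit_of s leads_root by simp
    then show ?case using leads.leads_root by metis
  next
    case (leads_step C C' R)
    then obtain u where u: "s C (exit_of (s C) C) = Some u" "C' = cl u"
      using s(2)[of C] by (auto simp: quot_def)
    have e: "exit_of (s C) C \<in> C" "exit_of (s C) C \<in> V" using exit_of s leads_step P_sub by blast+
    have fe: "f (exit_of (s C) C) = Some u" using fC e u leads_step by simp
    then have uV: "u \<in> V" using fV e by blast
    then have "C' \<in> P" "u \<in> C'" using cl u by auto
    then have "\<exists>r. leads f u r" using inner leads_step.IH by blast
    then show ?case using fe leads.leads_step by metis
  qed
  have "\<exists>r. leads f v r" if "v \<in> V" for v
  proof -
    have c: "cl v \<in> P" "v \<in> cl v" using cl that by auto
    then obtain R where "leads h (cl v) R" using h by (auto simp: forest_def)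
    then show ?thesis using inner[OF c exit[OF _ c(1)]] by blast
  qed
  moreover have "f v \<in> insert None (Some ` V)" if "v \<in> V" for v
    using fV[OF that] by (cases "f v") auto
  ultimately have "forest V UNIV f" by (simp add: forest_def fclosed_def)
  then have fOm: "f \<in> Om" using Om_mix s(1) fC by metis
  have "quot f C = h C" if C: "C \<in> P" for C
  proof -
    have "exits f C = exits (s C) C" using fC[OF C] by (auto simp: exits_def)
    then have e: "exit_of f C = exit_of (s C) C" by (simp add: exit_of_def)
    then have "quot f C = quot (s C) C" using fC[OF C] exit_of[OF fOm C] by (simp add: quot_def)
    then show ?thesis using s C by simp
  qed
  then show ?thesis using fOm by blast
qed

text \<open>\<open>mixed_separation\<close> is applied to the contracted forests and its result
  lifted back; contraction preserves the root number and which vertices are separated.\<close>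

lemma separating_optimum:
  assumes F: "F \<in> Om" "card (roots V F) = k" and G: "G \<in> Om" "card (roots V G) = k"
    and ab: "a \<in> V" "b \<in> V" and z: "quot F (cl a) = Some (cl z)" "z \<in> V"
    and av: "cl a \<notin> orbit (quot F) (cl b)"
    and tog: "\<exists>r. leads G a r \<and> leads G b r" and sep: "\<not> (\<exists>r. leads G a r \<and> leads G z r)"
  shows "\<exists>f\<in>Om. card (roots V f) = k \<and> \<not> (\<exists>r. leads f a r \<and> leads f b r)"
proof -
  obtain t where t: "leads (quot G) (cl a) t" "leads (quot G) (cl b) t"
    using tog leads_iff_quot G ab by blast
  obtain q where "leads G z q" using forest_leads[OF Om_forest[OF G(1)] z(2)] by blast
  then have q: "leads (quot G) (cl z) (cl q)" using leads_quot G z by blast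
  have "cl q \<noteq> t" using sep leads_iff_quot[OF G(1) ab(1) z(2)] t q by blast
  moreover have "card (roots P (quot F)) = card (roots P (quot G))" using F G quot_roots by simp
  ultimately obtain h where h: "forest P quot_choices h" "card (roots P h) = card (roots P (quot F))"
    "\<forall>r. \<not> (leads h (cl a) r \<and> leads h (cl b) r)"
    using mixed_separation[OF finite_P quot_forest[OF F(1)] quot_forest[OF G(1)] _ _ _ z(1) av t q] cl ab
    by blast
  obtain f where f: "f \<in> Om" "\<forall>C\<in>P. quot f C = h C" using quot_lift[OF h(1)] by blast
  have "roots P (quot f) = roots P h" using f by (auto simp: roots_def)
  then have "card (roots V f) = k" using h quot_roots f F by metis
  moreover have "\<not> (\<exists>r. leads f a r \<and> leads f b r)"
  proof
    assume "\<exists>r. leads f a r \<and> leads f b r"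
    then obtain R where R: "leads (quot f) (cl a) R" "leads (quot f) (cl b) R"
      using leads_iff_quot f ab by blast
    have "fclosed (quot f) P" using quot_forest[OF f(1)] by (simp add: forest_def)
    then have "leads h (cl a) R" "leads h (cl b) R"
      using leads_cong_on[of "quot f" _ R P h] R f(2) cl ab by auto
    then show False using h(3) by blast
  qed
  ultimately show ?thesis using f by blast
qed

text \<open>By \<open>key\<close>, the class of a non-root exit lies on the contracted path of every
  other exit. Two non-roots would lie on each other's path, two roots cannot share a tree, and the
  path of a root consists of its own class only.\<close>

lemma atom_single_exit:
  assumes F: "F \<in> Om" "card (roots V F) = k" and E: "E \<subseteq> V"
    and tog: "\<And>x y f. x \<in> E \<Longrightarrow> y \<in> E \<Longrightarrow> f \<in> Om \<Longrightarrow> card (roots V f) = k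
      \<Longrightarrow> \<exists>r. leads f x r \<and> leads f y r"
    and sep: "\<And>x z. x \<in> E \<Longrightarrow> z \<in> V - E \<Longrightarrow>
      \<exists>f\<in>Om. card (roots V f) = k \<and> \<not> (\<exists>r. leads f x r \<and> leads f z r)"
    and a: "a \<in> exits F E" and b: "b \<in> exits F E"
  shows "a = b"
proof (rule ccontr)
  assume ne: "a \<noteq> b"
  \<comment> \<open>Members of one class share a root in every member of \<open>Om\<close>, so
    \<open>E\<close> splits no class, and an exit of \<open>E\<close> is the exit of its
    class.\<close>
  have clE: "cl x \<subseteq> E" if x: "x \<in> E" for x
  proof (rule ccontr)
    assume "\<not> cl x \<subseteq> E"
    then obtain z where z: "z \<in> cl x" "z \<notin> E" by blast
    have x': "cl x \<in> P" "x \<in> cl x" using cl x E by auto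
    then have "z \<in> V - E" using z P_sub by blast
    then obtain f where "f \<in> Om" "\<not> (\<exists>r. leads f x r \<and> leads f z r)" using sep x by blast
    then show False using same_class_together x' z by blast
  qed
  have ex: "c \<in> V" "c = exit_of F (cl c)" if c: "c \<in> exits F E" for c
  proof -
    have cE: "c \<in> E" "F c \<notin> Some ` E" using c by (auto simp: exits_def)
    then show "c \<in> V" using E by blast
    moreover have "F c \<notin> Some ` cl c" using cE clE by blast
    ultimately show "c = exit_of F (cl c)" using exit_eq F cl by blast
  qed
  have key: "cl c \<in> orbit (quot F) (cl d) \<or> F c = None"
    if c: "c \<in> exits F E" and d: "d \<in> exits F E" for c d
  proof (rule ccontr)
    assume n: "\<not> ?thesis"
    then obtain z where z: "F c = Some z" by auto
    have cE: "c \<in> E" "d \<in> E" "F c \<notin> Some ` E" using c d by (auto simp: exits_def)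
    then have zVE: "z \<in> V - E" using z succ_in F ex[OF c] by auto
    have "quot F (cl c) = Some (cl z)" using z ex[OF c] by (simp add: quot_def)
    moreover obtain G where G: "G \<in> Om" "card (roots V G) = k" "\<not> (\<exists>r. leads G c r \<and> leads G z r)"
      using sep cE zVE by blast
    ultimately obtain f where "f \<in> Om" "card (roots V f) = k" "\<not> (\<exists>r. leads f c r \<and> leads f d r)"
      using separating_optimum[OF F G(1,2), of c d z] ex[OF c] ex[OF d] zVE n tog[OF cE(1,2) G(1,2)] by blast
    then show False using tog cE by blast
  qed
  have clne: "cl a \<noteq> cl b" using ex a b ne by metis
  have abE: "a \<in> E" "b \<in> E" using a b by (auto simp: exits_def)
  have orb_root: "orbit (quot F) (cl c) = {cl c}" if c: "c \<in> exits F E" "F c = None" for c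
  proof -
    have "quot F (cl c) = None" using c ex[OF c(1)] by (simp add: quot_def)
    then have "fclosed (quot F) {cl c}" by (simp add: fclosed_def)
    then show ?thesis using orbit_subset[of "quot F" "{cl c}" "cl c"] orbit_self by auto
  qed
  obtain r where r: "leads F a r" "leads F b r" using tog[OF abE F] by blast
  consider "F a = None" "F b = None" | "F a = None" "F b \<noteq> None" | "F a \<noteq> None" "F b = None"
    | "F a \<noteq> None" "F b \<noteq> None" by blast
  then show False
  proof cases
    case 1
    then have "r = a" "r = b" using r leads_unique leads_root by metis+
    then show False using ne by simp
  next
    case 2
    then show False using key[OF b a] orb_root[OF a] clne by auto
  next
    case 3
    then show False using key[OF a b] orb_root[OF b] clne by auto
  next
    case 4
    have "leads (quot F) (cl a) (cl r)" using leads_quot F ex[OF a] r by blast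
    then show False using orbit_antisym key[OF a b] key[OF b a] 4 clne by metis
  qed
qed

end

text \<open>Singletons are added so that the maximal sets cover \<open>V\<close>; every forest
  leaves a singleton once. Each \<open>S\<close> in \<open>L\<close> lies inside one class, so its
  exits are those of the forest copied onto that class.\<close>

lemma laminar_class_mixing:
  assumes V: "finite V" and L: "laminar L" "\<And>S. S \<in> L \<Longrightarrow> S \<subseteq> V \<and> S \<noteq> {}"
  defines "L' \<equiv> L \<union> (\<lambda>v. {v}) ` V"
  shows "class_mixing V {S \<in> L'. \<forall>S'\<in>L'. S \<subseteq> S' \<longrightarrow> S' = S}
    {f. forest V Z f \<and> (\<forall>S\<in>L. card (exits f S) = 1)}"
proof -
  define P where "P = {S \<in> L'. \<forall>S'\<in>L'. S \<subseteq> S' \<longrightarrow> S' = S}"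
  define Om where "Om = {f. forest V Z f \<and> (\<forall>S\<in>L. card (exits f S) = 1)}"
  have lam: "laminar L'" using L by (auto simp: laminar_def L'_def)
  have sub: "S \<subseteq> V" if "S \<in> L'" for S using that L by (auto simp: L'_def)
  have "L' \<subseteq> Pow V" using sub by blast
  then have fin: "finite L'" using V finite_subset by auto
  have above: "\<exists>C\<in>P. S \<subseteq> C" if "S \<in> L'" for S
  proof -
    obtain C where "C \<in> L'" "S \<subseteq> C" "\<forall>b\<in>L'. C \<subseteq> b \<longrightarrow> C = b"
      using finite_has_maximal2[OF fin \<open>S \<in> L'\<close>] by metis
    then show ?thesis unfolding P_def by blast
  qed
  have disj: "C = C'" if "C \<in> P" "C' \<in> P" "v \<in> C" "v \<in> C'" for C C' v
  proof -
    have "C \<in> L'" "C' \<in> L'" using that by (auto simp: P_def)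
    then have "C \<subseteq> C' \<or> C' \<subseteq> C" using lam that(3,4) unfolding laminar_def by fast
    then show ?thesis using that(1,2) by (auto simp: P_def)
  qed
  have "class_mixing V P Om"
  proof
    show "finite V" by fact
    show "C \<subseteq> V" if "C \<in> P" for C using that sub by (auto simp: P_def)
    show "\<exists>!C. C \<in> P \<and> v \<in> C" if "v \<in> V" for v
    proof -
      have "{v} \<in> L'" using that by (simp add: L'_def)
      from above[OF this] obtain C where C: "C \<in> P" "v \<in> C" by auto
      show ?thesis
      proof (rule ex1I)
        show "C \<in> P \<and> v \<in> C" using C by (rule conjI)
        show "C' = C" if "C' \<in> P \<and> v \<in> C'" for C'
          using disj[OF _ C(1) _ C(2)] that by (elim conjE)
      qed
    qed
    show "forest V UNIV f" if "f \<in> Om" for f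
      using that forest_mono[of V Z f UNIV] by (simp add: Om_def)
    show "card (exits f C) = 1"
      if f: "f \<in> Om" and C: "C \<in> P" for f C
    proof (cases "C \<in> L")
      case False
      then obtain v where v: "v \<in> V" "C = {v}" using C by (auto simp: P_def L'_def)
      have "card (exits f C) \<ge> 1" using f v by (intro forest_exits_card[OF V, of Z]) (auto simp: Om_def)
      moreover have "card (exits f C) \<le> card C" using v by (intro card_mono) (auto simp: exits_def)
      ultimately show ?thesis using v by simp
    qed (use f in \<open>simp add: Om_def\<close>)
    show "h \<in> Om"
      if h: "forest V UNIV h"
        and ex: "\<And>C. C \<in> P \<Longrightarrow> \<exists>f\<in>Om. \<forall>v\<in>C. h v = f v" for h
    proof -
      have "(v, h v) \<in> Z" if v: "v \<in> V" for v
      proof -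
        have "{v} \<in> L'" using v by (simp add: L'_def)
        from above[OF this] obtain C where C: "C \<in> P" "v \<in> C" by auto
        from ex[OF C(1)] C(2) obtain f where "forest V Z f" "h v = f v" by (auto simp: Om_def)
        then show ?thesis using v by (auto simp: forest_def)
      qed
      then have "forest V Z h" using h by (simp add: forest_def)
      moreover have "card (exits h S) = 1" if S: "S \<in> L" for S
      proof -
        have "S \<in> L'" using S by (simp add: L'_def)
        from above[OF this] obtain C where C: "C \<in> P" "S \<subseteq> C" by blast
        from ex[OF C(1)] obtain f where f: "\<forall>S\<in>L. card (exits f S) = 1" "\<forall>v\<in>C. h v = f v"
          by (auto simp: Om_def)
        have "exits h S = exits f S" using f(2) C(2) by (auto simp: exits_def)
        then show ?thesis using f S by simp
      qed
      ultimately show ?thesis by (simp add: Om_def)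
    qed
  qed
  then show ?thesis by (simp only: P_def Om_def)
qed

section \<open>Arc sets and successor functions\<close>

definition rel_of :: "'a set \<Rightarrow> ('a \<Rightarrow> 'a option) \<Rightarrow> ('a \<times> 'a) set" where
  "rel_of V f = {(v, u). v \<in> V \<and> f v = Some u}"

definition all_choices :: "'a set \<Rightarrow> ('a \<times> 'a) set \<Rightarrow> ('a \<times> 'a option) set" where
  "all_choices V As = {(v, Some u) | v u. (v, u) \<in> As} \<union> {(v, None) | v. v \<in> V}"

lemma leads_rtrancl: "leads f x r \<Longrightarrow> fclosed f V \<Longrightarrow> x \<in> V \<Longrightarrow> (x, r) \<in> (rel_of V f)\<^sup>*"
proof (induction rule: leads.induct)
  case (leads_step v u r)
  then have "u \<in> V" "(v, u) \<in> rel_of V f" by (force simp: fclosed_def rel_of_def)+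
  then show ?case using leads_step by (meson converse_rtrancl_into_rtrancl)
qed simp

text \<open>Traversing an arc in either direction keeps the root.\<close>

lemma weakly_connected_iff:
  assumes f: "forest V Op f" and xy: "x \<in> V" "y \<in> V"
  shows "(x, y) \<in> (rel_of V f \<union> (rel_of V f)\<inverse>)\<^sup>* \<longleftrightarrow> (\<exists>r. leads f x r \<and> leads f y r)"
proof
  assume a: "(x, y) \<in> (rel_of V f \<union> (rel_of V f)\<inverse>)\<^sup>*"
  obtain r where r: "leads f x r" using f xy by (auto simp: forest_def)
  from a have "leads f y r"
  proof (induction rule: rtrancl_induct)
    case (step y z)
    then consider "f y = Some z" | "f z = Some y" by (auto simp: rel_of_def)
    then show ?case using step.IH leads_stepD leads_step by metis
  qed (fact r)
  then show "\<exists>r. leads f x r \<and> leads f y r" using r by blast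
next
  assume "\<exists>r. leads f x r \<and> leads f y r"
  then obtain r where r: "leads f x r" "leads f y r" by blast
  let ?U = "rel_of V f \<union> (rel_of V f)\<inverse>"
  have c: "fclosed f V" using f by (simp add: forest_def)
  have up: "(u, r) \<in> ?U\<^sup>*" if "leads f u r" "u \<in> V" for u
    using leads_rtrancl[OF that(1) c that(2)] rtrancl_mono[of "rel_of V f" ?U] by blast
  have "sym (?U\<^sup>*)" by (rule sym_rtrancl) (auto simp: sym_def)
  then have "(r, y) \<in> ?U\<^sup>*" using up[OF r(2) xy(2)] by (auto simp: sym_def)
  then show "(x, y) \<in> ?U\<^sup>*" using up[OF r(1) xy(1)] by (meson rtrancl_trans)
qed

lemma components_rel_of:
  assumes f: "forest V Op f"
  shows "components V (rel_of V f) = (\<lambda>r. {v \<in> V. leads f v r}) ` roots V f"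
proof -
  have cls: "weak_rel V (rel_of V f) `` {x} = {v \<in> V. leads f v r}" if "x \<in> V" "leads f x r" for x r
  proof -
    have "(\<exists>s. leads f x s \<and> leads f y s) \<longleftrightarrow> leads f y r" for y
      using leads_unique[OF that(2)] that(2) by metis
    then have "y \<in> weak_rel V (rel_of V f) `` {x} \<longleftrightarrow> y \<in> {v \<in> V. leads f v r}" for y
      using weakly_connected_iff[OF f that(1), of y] that(1) by (simp add: weak_rel_def) blast
    then show ?thesis by (intro set_eqI)
  qed
  show ?thesis
  proof
    show "components V (rel_of V f) \<subseteq> (\<lambda>r. {v \<in> V. leads f v r}) ` roots V f"
    proof
      fix X assume "X \<in> components V (rel_of V f)"
      then obtain x where x: "x \<in> V" "X = weak_rel V (rel_of V f) `` {x}"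
        by (auto simp: components_def quotient_def)
      obtain r where "r \<in> roots V f" "leads f x r" using forest_leads[OF f x(1)] by blast
      then show "X \<in> (\<lambda>r. {v \<in> V. leads f v r}) ` roots V f" using cls x by auto
    qed
    show "(\<lambda>r. {v \<in> V. leads f v r}) ` roots V f \<subseteq> components V (rel_of V f)"
    proof
      fix X assume "X \<in> (\<lambda>r. {v \<in> V. leads f v r}) ` roots V f"
      then obtain r where r: "r \<in> V" "f r = None" "X = {v \<in> V. leads f v r}" by (auto simp: roots_def)
      then have "X = weak_rel V (rel_of V f) `` {r}" using cls leads_root by metis
      then show "X \<in> components V (rel_of V f)" using r by (auto simp: components_def quotient_def)
    qed
  qed
qed

lemma card_components_rel_of:
  assumes f: "forest V Op f"
  shows "card (components V (rel_of V f)) = card (roots V f)"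
proof -
  have "inj_on (\<lambda>r. {v \<in> V. leads f v r}) (roots V f)"
  proof (rule inj_onI)
    fix r s assume rs: "r \<in> roots V f" "s \<in> roots V f" "{v \<in> V. leads f v r} = {v \<in> V. leads f v s}"
    then have "leads f r r" "r \<in> V" by (auto simp: roots_def leads_root)
    then have "leads f r s" using rs(3) by blast
    then show "r = s" using \<open>leads f r r\<close> leads_unique by metis
  qed
  then show ?thesis using components_rel_of[OF f] card_image by metis
qed

lemma is_forest_rel_of:
  assumes f: "forest V (all_choices V As) f"
  shows "rel_of V f \<subseteq> As" "is_forest V (rel_of V f)"
proof -
  show "rel_of V f \<subseteq> As"
  proof
    fix p assume "p \<in> rel_of V f"
    then obtain v u where p: "p = (v, u)" "v \<in> V" "f v = Some u" by (auto simp: rel_of_def)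
    then have "(v, Some u) \<in> all_choices V As" using f by (metis forest_def)
    then show "p \<in> As" using p by (auto simp: all_choices_def)
  qed
  have "(v, v) \<notin> (rel_of V f)\<^sup>+" for v
  proof
    assume a: "(v, v) \<in> (rel_of V f)\<^sup>+"
    have "rel_of V f \<subseteq> {(a, b). f a = Some b}" by (auto simp: rel_of_def)
    then have "(v, v) \<in> {(a, b). f a = Some b}\<^sup>+" using trancl_mono[OF a] by blast
    moreover have "v \<in> V" using a by (auto dest!: tranclD simp: rel_of_def)
    ultimately show False using f leads_no_cycle[of f v] unfolding forest_def by blast
  qed
  moreover have "rel_of V f \<subseteq> V \<times> V"
    using f by (force simp: rel_of_def forest_def fclosed_def)
  ultimately show "is_forest V (rel_of V f)"
    by (auto simp: is_forest_def digraph_def acyclic_def rel_of_def)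
qed

text \<open>A finite acyclic relation has a well-founded converse, so following arcs forward
  terminates.\<close>

lemma is_forest_imp_rel_of:
  assumes V: "finite V" and F: "F \<subseteq> As" "is_forest V F"
  shows "\<exists>f. forest V (all_choices V As) f \<and> F = rel_of V f"
proof -
  have FV: "F \<subseteq> V \<times> V" and uniq: "\<And>v u w. (v, u) \<in> F \<Longrightarrow> (v, w) \<in> F \<Longrightarrow> u = w" and ac: "acyclic F"
    using F(2) by (auto simp: is_forest_def digraph_def)
  define f where "f v = (if \<exists>u. (v, u) \<in> F then Some (SOME u. (v, u) \<in> F) else None)" for v
  have fS: "f v = Some u \<longleftrightarrow> (v, u) \<in> F" for u v
  proof
    assume "f v = Some u"
    then have "\<exists>u. (v, u) \<in> F" "u = (SOME u. (v, u) \<in> F)" by (auto simp: f_def split: if_splits)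
    then show "(v, u) \<in> F" using someI_ex[of "\<lambda>u. (v, u) \<in> F"] by simp
  next
    assume a: "(v, u) \<in> F"
    then have "(SOME u. (v, u) \<in> F) = u" using uniq by (intro some_equality) auto
    then show "f v = Some u" using a by (auto simp: f_def)
  qed
  have "finite F" using FV V finite_subset by blast
  then have wf: "wf (F\<inverse>)" using ac finite_acyclic_wf_converse by blast
  have lead: "\<exists>r. leads f v r" for v
    using wf
  proof (induction v rule: wf_induct_rule)
    case (less v)
    show ?case
    proof (cases "f v")
      case None
      then show ?thesis using leads_root by metis
    next
      case (Some u)
      then have "(u, v) \<in> F\<inverse>" using fS by simp
      then show ?thesis using less Some leads_step by metis
    qed
  qed
  have "(v, f v) \<in> all_choices V As \<and> f v \<in> insert None (Some ` V)" if "v \<in> V" for v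
  proof (cases "f v")
    case (Some u)
    then have "(v, u) \<in> F" using fS by simp
    then show ?thesis using Some F FV by (auto simp: all_choices_def)
  qed (use that in \<open>simp add: all_choices_def\<close>)
  then have "forest V (all_choices V As) f" using lead by (auto simp: forest_def fclosed_def)
  moreover have "F = rel_of V f" using fS FV by (auto simp: rel_of_def)
  ultimately show ?thesis by blast
qed

lemma spanning_forests_iff:
  assumes "finite V"
  shows "F \<in> spanning_forests V As k \<longleftrightarrow>
    (\<exists>f. forest V (all_choices V As) f \<and> card (roots V f) = k \<and> F = rel_of V f)"
proof
  assume F: "F \<in> spanning_forests V As k"
  then obtain f where "forest V (all_choices V As) f" "F = rel_of V f"
    using is_forest_imp_rel_of[OF assms, of F As] by (auto simp: spanning_forests_def)
  moreover then have "card (roots V f) = k"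
    using F card_components_rel_of[of V "all_choices V As" f] by (simp add: spanning_forests_def)
  ultimately show "\<exists>f. forest V (all_choices V As) f \<and> card (roots V f) = k \<and> F = rel_of V f"
    by blast
next
  assume "\<exists>f. forest V (all_choices V As) f \<and> card (roots V f) = k \<and> F = rel_of V f"
  then obtain f where f: "forest V (all_choices V As) f" "card (roots V f) = k" "F = rel_of V f"
    by blast
  then show "F \<in> spanning_forests V As k"
    using is_forest_rel_of[OF f(1)] card_components_rel_of[OF f(1)]
    by (simp add: spanning_forests_def)
qed

text \<open>The Lagrangian for minimising the weight under a prescribed number of roots, with
  multiplier \<open>l\<close>.\<close>

definition option_cost :: "real \<Rightarrow> ('a \<Rightarrow> 'a \<Rightarrow> real) \<Rightarrow> 'a \<Rightarrow> 'a option \<Rightarrow> real" where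
  "option_cost l v i w = (case w of None \<Rightarrow> l | Some j \<Rightarrow> v i j)"

lemma option_cost_sum:
  assumes V: "finite V"
  shows "(\<Sum>i\<in>V. option_cost l v i (f i)) = weight v (rel_of V f) + l * card (roots V f)"
proof -
  let ?A = "{i \<in> V. f i \<noteq> None}"
  have "rel_of V f = (\<lambda>i. (i, the (f i))) ` ?A" by (force simp: rel_of_def)
  moreover have "inj_on (\<lambda>i. (i, the (f i))) ?A" by (auto simp: inj_on_def)
  ultimately have "weight v (rel_of V f) = (\<Sum>i\<in>?A. v i (the (f i)))"
    unfolding weight_def by (simp add: sum.reindex)
  also have "\<dots> = (\<Sum>i\<in>?A. option_cost l v i (f i))"
    by (intro sum.cong) (auto simp: option_cost_def)
  finally have 1: "weight v (rel_of V f) = (\<Sum>i\<in>?A. option_cost l v i (f i))" .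
  have 2: "(\<Sum>i\<in>roots V f. option_cost l v i (f i)) = l * card (roots V f)"
    by (simp add: roots_def option_cost_def)
  have "V = ?A \<union> roots V f" by (auto simp: roots_def)
  then have "(\<Sum>i\<in>V. option_cost l v i (f i)) = (\<Sum>i\<in>?A \<union> roots V f. option_cost l v i (f i))" by simp
  also have "\<dots> = (\<Sum>i\<in>?A. option_cost l v i (f i)) + (\<Sum>i\<in>roots V f. option_cost l v i (f i))"
    using V by (intro sum.union_disjoint) (auto simp: roots_def)
  finally show ?thesis using 1 2 by simp
qed

section \<open>Convexity of the minimal weights\<close>

text \<open>Some tree \<open>T\<close> of \<open>g\<close> contains no root of \<open>f\<close>. The
  choices on \<open>T\<close> can be exchanged because \<open>T\<close> and its complement are both
  closed under \<open>g\<close>: \<open>f\<close> gains the root \<open>q\<close>, \<open>g\<close>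
  loses it, and the two choices at each vertex are at most interchanged.\<close>

lemma tree_swap:
  fixes c :: "'a \<Rightarrow> 'a option \<Rightarrow> real"
  assumes V: "finite V" and f: "forest V Op f" and g: "forest V Op g"
    and lt: "card (roots V f) < card (roots V g)"
  obtains f' g' where "forest V Op f'" "forest V Op g'"
    "card (roots V f') = card (roots V f) + 1" "card (roots V g') = card (roots V g) - 1"
    "(\<Sum>v\<in>V. c v (f' v)) + (\<Sum>v\<in>V. c v (g' v)) = (\<Sum>v\<in>V. c v (f v)) + (\<Sum>v\<in>V. c v (g v))"
proof -
  have fin: "finite (roots V f)" "finite (roots V g)" using V by (auto simp: roots_def)
  \<comment> \<open>Otherwise distinct roots of \<open>g\<close> would be reached from distinct
    roots of \<open>f\<close>.\<close>
  have "\<exists>q\<in>roots V g. \<forall>r\<in>roots V f. \<not> leads g r q"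
  proof (rule ccontr)
    assume "\<not> ?thesis"
    then have "\<forall>q\<in>roots V g. \<exists>r. r \<in> roots V f \<and> leads g r q" by blast
    from bchoice[OF this] obtain \<rho> where \<rho>: "\<forall>q\<in>roots V g. \<rho> q \<in> roots V f \<and> leads g (\<rho> q) q" by blast
    then have "inj_on \<rho> (roots V g)" using leads_unique by (metis inj_onI)
    then have "card (roots V g) \<le> card (roots V f)" using \<rho> fin by (intro card_inj_on_le[of \<rho>]) auto
    then show False using lt by simp
  qed
  then obtain q where q: "q \<in> roots V g" and no: "\<And>r. r \<in> roots V f \<Longrightarrow> \<not> leads g r q" by blast
  define T where "T = {v \<in> V. leads g v q}"
  have gV: "fclosed g V" using g by (simp add: forest_def)
  have qT: "leads g q q" "q \<in> T" using q leads_root[of g q] by (auto simp: T_def roots_def)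
  have T1: "fclosed g T"
    using gV leads_stepD[of g _ q] by (force simp: fclosed_def T_def)
  have T2: "fclosed g (V - T)"
    unfolding fclosed_def
  proof
    fix v assume v: "v \<in> V - T"
    show "g v \<in> insert None (Some ` (V - T))"
    proof (cases "g v")
      case (Some u)
      then have "u \<in> V" using gV v by (force simp: fclosed_def)
      moreover have "u \<notin> T" using v Some leads_step[of g v u q] by (auto simp: T_def)
      ultimately show ?thesis using Some by simp
    qed simp
  qed
  have Troot: "v = q" if "v \<in> T" "g v = None" for v
    using that leads_root[of g v] leads_unique by (fastforce simp: T_def)
  define f' where "f' = mix T g f"
  define g' where "g' = mix (V - T) g f"
  have 1: "forest V Op f'" unfolding f'_def using T1 by (intro forest_mix[OF f g]) (auto simp: T_def)
  have 2: "forest V Op g'" unfolding g'_def using T2 by (intro forest_mix[OF f g]) auto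
  have fT: "v \<notin> T" if "v \<in> roots V f" for v using no[OF that] by (simp add: T_def)
  have "roots V f' = insert q (roots V f)"
  proof (rule set_eqI)
    fix v
    show "v \<in> roots V f' \<longleftrightarrow> v \<in> insert q (roots V f)"
    proof (cases "v \<in> T")
      case True
      then have "v \<in> roots V f' \<longleftrightarrow> v = q"
        using q Troot[of v] by (auto simp: f'_def mix_def roots_def)
      then show ?thesis using fT[of v] True by blast
    next
      case False
      then have "v \<noteq> q" using qT by blast
      then show ?thesis using False by (simp add: f'_def mix_def roots_def)
    qed
  qed
  moreover have "q \<notin> roots V f" using fT qT by blast
  ultimately have 3: "card (roots V f') = card (roots V f) + 1" using fin by simp
  have "roots V g' = roots V g - {q}"
  proof (rule set_eqI)
    fix v
    show "v \<in> roots V g' \<longleftrightarrow> v \<in> roots V g - {q}"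
    proof (cases "v \<in> T")
      case True
      then have "v \<notin> roots V g'" using fT[of v] by (force simp: g'_def mix_def roots_def)
      then show ?thesis using Troot[OF True] by (auto simp: roots_def)
    next
      case False
      then have "v \<noteq> q" using qT by blast
      then show ?thesis using False by (auto simp: g'_def mix_def roots_def)
    qed
  qed
  then have 4: "card (roots V g') = card (roots V g) - 1" using q fin by simp
  have "(\<Sum>v\<in>V. c v (f' v) + c v (g' v)) = (\<Sum>v\<in>V. c v (f v) + c v (g v))"
    by (intro sum.cong) (auto simp: f'_def g'_def mix_def)
  then have 5: "(\<Sum>v\<in>V. c v (f' v)) + (\<Sum>v\<in>V. c v (g' v)) = (\<Sum>v\<in>V. c v (f v)) + (\<Sum>v\<in>V. c v (g v))"
    by (simp add: sum.distrib)
  show thesis using that[OF 1 2 3 4 5] .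
qed

text \<open>Convexity makes the decrements \<open>s\<close> antitone, so a value of \<open>l\<close>
  at most every decrement before \<open>k\<close> and at least every one from \<open>k\<close> on is
  a supporting slope.\<close>

lemma convex_supporting_line:
  fixes \<phi> :: "nat \<Rightarrow> real"
  assumes conv: "\<And>m. 1 \<le> m \<Longrightarrow> m + 2 \<le> N \<Longrightarrow> 2 * \<phi> (m + 1) \<le> \<phi> m + \<phi> (m + 2)"
    and k: "1 \<le> k" "k \<le> N"
  shows "\<exists>l::real. \<forall>m. 1 \<le> m \<longrightarrow> m \<le> N \<longrightarrow> \<phi> k + l * k \<le> \<phi> m + l * m"
proof -
  define s where "s m = \<phi> m - \<phi> (m + 1)" for m
  have anti: "s j \<le> s i" if ij: "1 \<le> i" "i \<le> j" "j < N" for i j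
    using ij(2,3)
  proof (induction j rule: dec_induct)
    case (step j)
    then show ?case using conv[of j] ij(1) by (simp add: s_def)
  qed simp
  have "\<exists>l. (\<forall>m. 1 \<le> m \<longrightarrow> m < k \<longrightarrow> l \<le> s m) \<and> (\<forall>m. k \<le> m \<longrightarrow> m < N \<longrightarrow> s m \<le> l)"
  \<comment> \<open>\<open>s k\<close> is in range only for \<open>k < N\<close>; at the right end
    the preceding decrement serves, and for \<open>k = N = 1\<close> any value would do.\<close>
  proof (cases "k < N")
    case True
    then show ?thesis using anti k by (intro exI[of _ "s k"]) auto
  next
    case False
    then show ?thesis using anti k by (intro exI[of _ "s (k - 1)"]) auto
  qed
  then obtain l where l: "\<And>m. 1 \<le> m \<Longrightarrow> m < k \<Longrightarrow> l \<le> s m" "\<And>m. k \<le> m \<Longrightarrow> m < N \<Longrightarrow> s m \<le> l" by blast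
  have up: "\<phi> k + l * k \<le> \<phi> m + l * m" if "k \<le> m" "m \<le> N" for m
    using that
  proof (induction m rule: dec_induct)
    case (step m)
    then show ?case using l(2)[of m] by (simp add: s_def algebra_simps)
  qed simp
  have down: "\<phi> k + l * k \<le> \<phi> m + l * m" if "m \<le> k" "1 \<le> m" for m
    using that
  proof (induction m rule: inc_induct)
    case (step m)
    then show ?case using l(1)[of m] by (simp add: s_def algebra_simps)
  qed simp
  have "\<phi> k + l * k \<le> \<phi> m + l * m" if "1 \<le> m" "m \<le> N" for m
    using up down that by (cases "k \<le> m") auto
  then show ?thesis by blast
qed

lemma finite_spanning_forests: "finite V \<Longrightarrow> digraph V As \<Longrightarrow> finite (spanning_forests V As m)"
  by (rule finite_subset[of _ "Pow (V \<times> V)"]) (auto simp: spanning_forests_def digraph_def)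

lemma phi_le:
  assumes "finite V" "digraph V As" "forest V (all_choices V As) f" "card (roots V f) = m"
  shows "phi V As v m \<le> weight v (rel_of V f)"
proof -
  have "rel_of V f \<in> spanning_forests V As m" using spanning_forests_iff assms by blast
  then show ?thesis using finite_spanning_forests[OF assms(1,2)] by (auto simp: phi_def intro!: Min_le)
qed

text \<open>Cutting the given spanning tree at \<open>m - 1\<close> further vertices yields
  \<open>m\<close> roots, so \<open>phi\<close> is a minimum over a nonempty finite set.\<close>

lemma phi_attained:
  assumes V: "finite V" and As: "digraph V As" and tree: "spanning_forests V As 1 \<noteq> {}"
    and m: "1 \<le> m" "m \<le> card V"
  shows "\<exists>f. forest V (all_choices V As) f \<and> card (roots V f) = m \<and> weight v (rel_of V f) = phi V As v m"
proof -
  obtain f1 where f1: "forest V (all_choices V As) f1" "card (roots V f1) = 1"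
    using tree spanning_forests_iff[OF V] by blast
  obtain R where R: "roots V f1 \<subseteq> R" "R \<subseteq> V" "card R = m"
    using exists_subset_between[of "roots V f1" m V] f1 m V by (auto simp: roots_def)
  let ?f = "mix R (\<lambda>_. None) f1"
  have "forest V (all_choices V As) ?f" using R by (intro forest_cut[OF f1(1)]) (auto simp: all_choices_def)
  moreover have "roots V ?f = R" using R by (auto simp: roots_def mix_def)
  ultimately have "rel_of V ?f \<in> spanning_forests V As m"
    unfolding spanning_forests_iff[OF V] using R(3) by (intro exI[of _ ?f]) simp
  then have "weight v ` spanning_forests V As m \<noteq> {}" by blast
  then have "phi V As v m \<in> weight v ` spanning_forests V As m"
    unfolding phi_def using finite_spanning_forests[OF V As] by (intro Min_in) auto
  then show ?thesis using spanning_forests_iff[OF V] by auto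
qed

lemma phi_convex:
  assumes V: "finite V" and As: "digraph V As" and tree: "spanning_forests V As 1 \<noteq> {}"
    and m: "1 \<le> m" "m + 2 \<le> card V"
  shows "2 * phi V As v (m + 1) \<le> phi V As v m + phi V As v (m + 2)"
proof -
  obtain f where f: "forest V (all_choices V As) f" "card (roots V f) = m" "weight v (rel_of V f) = phi V As v m"
    using phi_attained[OF V As tree, of m v] m by auto
  obtain g where g: "forest V (all_choices V As) g" "card (roots V g) = m + 2"
    "weight v (rel_of V g) = phi V As v (m + 2)"
    using phi_attained[OF V As tree, of "m + 2" v] m by auto
  have "card (roots V f) < card (roots V g)" using f g by simp
  then obtain f' g' where f': "forest V (all_choices V As) f'" and g': "forest V (all_choices V As) g'"
    and fg': "card (roots V f') = card (roots V f) + 1" "card (roots V g') = card (roots V g) - 1"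
    and eq: "(\<Sum>i\<in>V. option_cost 0 v i (f' i)) + (\<Sum>i\<in>V. option_cost 0 v i (g' i))
      = (\<Sum>i\<in>V. option_cost 0 v i (f i)) + (\<Sum>i\<in>V. option_cost 0 v i (g i))"
    using tree_swap[OF V f(1) g(1), where c = "option_cost 0 v"] by blast
  have "card (roots V f') = m + 1" "card (roots V g') = m + 1" using fg' f(2) g(2) by simp_all
  then have "phi V As v (m + 1) \<le> weight v (rel_of V f')" "phi V As v (m + 1) \<le> weight v (rel_of V g')"
    using phi_le[OF V As f'] phi_le[OF V As g'] by auto
  then show ?thesis using eq f(3) g(3) by (simp add: option_cost_sum[OF V])
qed

text \<open>With \<open>l\<close> the supporting slope at \<open>k\<close>, \<open>phi\<close> plus
  \<open>l\<close> per root is minimal at \<open>k\<close>, so a forest with \<open>k\<close> roots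
  minimises the Lagrangian exactly when its weight is \<open>phi\<close>.\<close>

lemma minimal_forests_optimal:
  assumes V: "finite V" and As: "digraph V As" and tree: "spanning_forests V As 1 \<noteq> {}"
    and k: "1 \<le> k" "k \<le> card V"
  shows "\<exists>l. \<forall>f. forest V (all_choices V As) f \<and> card (roots V f) = k \<longrightarrow>
    (rel_of V f \<in> minimal_forests V As v k \<longleftrightarrow>
     (\<forall>g. forest V (all_choices V As) g \<longrightarrow>
       (\<Sum>i\<in>V. option_cost l v i (f i)) \<le> (\<Sum>i\<in>V. option_cost l v i (g i))))"
proof -
  obtain l :: real where l: "\<And>m. 1 \<le> m \<Longrightarrow> m \<le> card V \<Longrightarrow> phi V As v k + l * k \<le> phi V As v m + l * m"
    using convex_supporting_line[of "card V" "phi V As v" k, OF phi_convex[OF V As tree] k] by auto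
  have Vne: "V \<noteq> {}" using k by auto
  have low: "phi V As v k + l * k \<le> (\<Sum>i\<in>V. option_cost l v i (g i))"
    if g: "forest V (all_choices V As) g" for g
  proof -
    have fin: "finite (roots V g)" using V by (simp add: roots_def)
    obtain x where "x \<in> V" using Vne by blast
    then have "roots V g \<noteq> {}" using forest_leads[OF g] by blast
    then have "1 \<le> card (roots V g)" using fin by (simp add: Suc_leI card_gt_0_iff)
    moreover have "card (roots V g) \<le> card V" using V by (intro card_mono) (auto simp: roots_def)
    ultimately have "phi V As v k + l * k \<le> phi V As v (card (roots V g)) + l * card (roots V g)"
      using l by blast
    then show ?thesis using phi_le[OF V As g refl, of v] by (simp add: option_cost_sum[OF V])
  qed
  obtain f0 where f0: "forest V (all_choices V As) f0" "card (roots V f0) = k"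
    "weight v (rel_of V f0) = phi V As v k"
    using phi_attained[OF V As tree k, of v] by blast
  have "rel_of V f \<in> minimal_forests V As v k \<longleftrightarrow>
     (\<forall>g. forest V (all_choices V As) g \<longrightarrow>
       (\<Sum>i\<in>V. option_cost l v i (f i)) \<le> (\<Sum>i\<in>V. option_cost l v i (g i)))"
    if f: "forest V (all_choices V As) f" "card (roots V f) = k" for f
  proof -
    have sp: "rel_of V f \<in> spanning_forests V As k" using spanning_forests_iff[OF V] f by blast
    have cf: "(\<Sum>i\<in>V. option_cost l v i (f i)) = weight v (rel_of V f) + l * k"
      using f by (simp add: option_cost_sum[OF V])
    show ?thesis
    proof
      assume "rel_of V f \<in> minimal_forests V As v k"
      then have "weight v (rel_of V f) = phi V As v k" by (simp add: minimal_forests_def)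
      then show "\<forall>g. forest V (all_choices V As) g \<longrightarrow>
          (\<Sum>i\<in>V. option_cost l v i (f i)) \<le> (\<Sum>i\<in>V. option_cost l v i (g i))"
        using low cf by simp
    next
      assume "\<forall>g. forest V (all_choices V As) g \<longrightarrow>
          (\<Sum>i\<in>V. option_cost l v i (f i)) \<le> (\<Sum>i\<in>V. option_cost l v i (g i))"
      then have "(\<Sum>i\<in>V. option_cost l v i (f i)) \<le> (\<Sum>i\<in>V. option_cost l v i (f0 i))"
        using f0 by blast
      then have "weight v (rel_of V f) \<le> phi V As v k"
        using cf f(2) f0 by (simp add: option_cost_sum[OF V])
      then have "weight v (rel_of V f) = phi V As v k" using phi_le[OF V As f, of v] by simp
      then show "rel_of V f \<in> minimal_forests V As v k" using sp by (simp add: minimal_forests_def)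
    qed
  qed
  then show ?thesis by blast
qed

section \<open>Atoms\<close>

lemma gen_algebra_subset: "X \<in> gen_algebra V Gs \<Longrightarrow> (\<And>X. X \<in> Gs \<Longrightarrow> X \<subseteq> V) \<Longrightarrow> X \<subseteq> V"
  by (induction rule: gen_algebra.induct) auto

text \<open>The sets that do not distinguish \<open>x\<close> from \<open>z\<close> are closed under
  complement and intersection.\<close>

lemma gen_algebra_not_separated:
  "X \<in> gen_algebra V Gs \<Longrightarrow> x \<in> V \<Longrightarrow> z \<in> V \<Longrightarrow> (\<And>X. X \<in> Gs \<Longrightarrow> x \<in> X \<longleftrightarrow> z \<in> X)
    \<Longrightarrow> x \<in> X \<longleftrightarrow> z \<in> X"
  by (induction rule: gen_algebra.induct) auto

lemma single_exit_is_tree: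
  assumes f: "forest V Op f" and F: "is_forest V (rel_of V f)" and E: "E \<subseteq> V" "E \<noteq> {}"
    and ex: "\<And>a b. a \<in> exits f E \<Longrightarrow> b \<in> exits f E \<Longrightarrow> a = b"
  shows "is_tree E (induced (rel_of V f) E)"
proof -
  let ?I = "induced (rel_of V f) E"
  have "acyclic ?I" using F by (auto simp: is_forest_def induced_def intro: acyclic_subset)
  then have forest: "is_forest E ?I"
    using F E(1) by (auto simp: is_forest_def digraph_def induced_def)
  obtain x where x: "x \<in> E" using E by blast
  then obtain r where "leads f x r" using f E by (auto simp: forest_def)
  from exits_nonempty[OF this x] obtain e where e: "e \<in> exits f E" by blast
  have up: "(x, e) \<in> ?I\<^sup>*" if x: "x \<in> E" for x
  proof -
    obtain r where "leads f x r" using f E x by (auto simp: forest_def)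
    then show ?thesis using x
    proof (induction rule: leads.induct)
      case (leads_root v)
      then have "v \<in> exits f E" by (auto simp: exits_def)
      then show ?case using ex e by blast
    next
      case (leads_step v u r)
      show ?case
      proof (cases "u \<in> E")
        case True
        then have "(v, u) \<in> ?I" using leads_step E by (auto simp: induced_def rel_of_def)
        then show ?thesis using leads_step.IH[OF True] by (rule converse_rtrancl_into_rtrancl)
      next
        case False
        then have "v \<in> exits f E" using leads_step by (auto simp: exits_def)
        then have "v = e" using ex e by blast
        then show ?thesis by simp
      qed
    qed
  qed
  have "(x, y) \<in> (?I \<union> ?I\<inverse>)\<^sup>*" if "x \<in> E" "y \<in> E" for x y
  proof -
    have up': "(u, e) \<in> (?I \<union> ?I\<inverse>)\<^sup>*" if "u \<in> E" for u
      using up[OF that] rtrancl_mono[of ?I "?I \<union> ?I\<inverse>"] by blast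
    have "sym ((?I \<union> ?I\<inverse>)\<^sup>*)" by (rule sym_rtrancl) (auto simp: sym_def)
    then have "(e, y) \<in> (?I \<union> ?I\<inverse>)\<^sup>*" using up'[OF that(2)] by (rule symD)
    then show ?thesis using up'[OF that(1)] by (rule rtrancl_trans[rotated])
  qed
  then show ?thesis using forest E(2) by (simp add: is_tree_def weakly_connected_def)
qed

theorem theorem5:
  fixes Vs :: "'a set" and As :: "('a \<times> 'a) set" and v :: "'a \<Rightarrow> 'a \<Rightarrow> real"
    and k :: nat and F :: "('a \<times> 'a) set" and E :: "'a set"
  assumes "finite Vs" and "digraph Vs As"
    and "spanning_forests Vs As 1 \<noteq> {}"
    and "k \<in> {1..card Vs}"
    and "F \<in> minimal_forests Vs As v k"
    and "is_atom (algebra_k Vs As v k) E"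
  shows "is_tree E (induced F E)"
proof -
  let ?Op = "all_choices Vs As"
  have k: "1 \<le> k" "k \<le> card Vs" using assms(4) by auto
  have minD: "\<exists>f. forest Vs ?Op f \<and> card (roots Vs f) = k \<and> G = rel_of Vs f"
    if "G \<in> minimal_forests Vs As v k" for G
    using that spanning_forests_iff[OF assms(1)] by (simp add: minimal_forests_def)
  obtain f where f: "forest Vs ?Op f" "card (roots Vs f) = k" "F = rel_of Vs f"
    using minD[OF assms(5)] by blast
  obtain l where l: "\<And>f. forest Vs ?Op f \<Longrightarrow> card (roots Vs f) = k \<Longrightarrow>
    (rel_of Vs f \<in> minimal_forests Vs As v k \<longleftrightarrow>
     (\<forall>g. forest Vs ?Op g \<longrightarrow>
       (\<Sum>i\<in>Vs. option_cost l v i (f i)) \<le> (\<Sum>i\<in>Vs. option_cost l v i (g i))))"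
    using minimal_forests_optimal[OF assms(1-3) k, of v] by blast
  have OpV: "?Op \<subseteq> Vs \<times> insert None (Some ` Vs)"
    using assms(2) by (auto simp: all_choices_def digraph_def)
  obtain L Z where L: "laminar L" "\<forall>S\<in>L. S \<subseteq> Vs \<and> S \<noteq> {}" and Z: "Z \<subseteq> ?Op"
    and opt: "\<And>f. forest Vs ?Op f \<Longrightarrow>
      (\<forall>g. forest Vs ?Op g \<longrightarrow>
        (\<Sum>i\<in>Vs. option_cost l v i (f i)) \<le> (\<Sum>i\<in>Vs. option_cost l v i (g i))) \<longleftrightarrow>
      forest Vs Z f \<and> (\<forall>S\<in>L. card (exits f S) = 1)"
    using optimal_forests_laminar[OF assms(1) OpV f(1), of "option_cost l v"] by auto
  \<comment> \<open>\<open>Om\<close> contains optima with any number of roots;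
    \<open>Om_iff\<close> identifies those with \<open>k\<close> roots as the minimal
    forests.\<close>
  define Om where "Om = {f. forest Vs Z f \<and> (\<forall>S\<in>L. card (exits f S) = 1)}"
  obtain P where "class_mixing Vs P Om"
    using laminar_class_mixing[OF assms(1) L(1), of Z] L(2) unfolding Om_def by blast
  then interpret class_mixing Vs P Om .
  have Om_iff: "g \<in> Om \<longleftrightarrow> rel_of Vs g \<in> minimal_forests Vs As v k"
    if "forest Vs ?Op g" "card (roots Vs g) = k" for g
    using l[OF that] opt[OF that(1)] by (simp add: Om_def)
  have Om_Op: "forest Vs ?Op g" if "g \<in> Om" for g
    using that Z forest_mono by (auto simp: Om_def)
  define Gs where "Gs = (\<Union>G\<in>minimal_forests Vs As v k. components Vs G)"
  have GsI: "{u \<in> Vs. leads g u r} \<in> Gs" if "g \<in> Om" "card (roots Vs g) = k" "r \<in> roots Vs g" for g r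
  proof -
    have "rel_of Vs g \<in> minimal_forests Vs As v k" using Om_iff Om_Op that by blast
    moreover have "{u \<in> Vs. leads g u r} \<in> components Vs (rel_of Vs g)"
      using components_rel_of[OF Om_Op[OF that(1)]] that(3) by blast
    ultimately show ?thesis unfolding Gs_def by blast
  qed
  have GsD: "\<exists>g r. g \<in> Om \<and> card (roots Vs g) = k \<and> X = {u \<in> Vs. leads g u r}" if X: "X \<in> Gs" for X
  proof -
    obtain G where G: "G \<in> minimal_forests Vs As v k" "X \<in> components Vs G"
      using X by (auto simp: Gs_def)
    obtain g where g: "forest Vs ?Op g" "card (roots Vs g) = k" "G = rel_of Vs g"
      using minD[OF G(1)] by blast
    then have "g \<in> Om" using Om_iff G(1) by blast
    moreover obtain r where "X = {u \<in> Vs. leads g u r}"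
      using components_rel_of[OF g(1)] G(2) g(3) by auto
    ultimately show ?thesis using g by blast
  qed
  have E: "E \<in> gen_algebra Vs Gs" "E \<noteq> {}" and Eat: "\<And>B. B \<in> gen_algebra Vs Gs \<Longrightarrow> E \<inter> B \<in> {{}, E}"
    using assms(6) by (auto simp: is_atom_def algebra_k_def Gs_def)
  have EV: "E \<subseteq> Vs" using gen_algebra_subset[OF E(1)] GsD by blast
  \<comment> \<open>The tree containing \<open>x\<close> is a generator meeting the atom
    \<open>E\<close>, so it contains \<open>E\<close>.\<close>
  have tog: "\<exists>r. leads g x r \<and> leads g y r"
    if xy: "x \<in> E" "y \<in> E" and g: "g \<in> Om" "card (roots Vs g) = k" for x y g
  proof -
    obtain r where r: "r \<in> roots Vs g" "leads g x r"
      using forest_leads[OF Om_Op[OF g(1)]] xy EV by blast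
    let ?B = "{u \<in> Vs. leads g u r}"
    have "E \<inter> ?B \<in> {{}, E}" using Eat GsI[OF g r(1)] gen_algebra.gen by blast
    moreover have "x \<in> E \<inter> ?B" using xy EV r by blast
    ultimately have "y \<in> ?B" using xy by blast
    then show ?thesis using r by blast
  qed
  \<comment> \<open>If no such forest separated \<open>x\<close> from \<open>z\<close>, no generator
    would distinguish them, and then neither would \<open>E\<close>, a member of the
    algebra.\<close>
  have sep: "\<exists>g\<in>Om. card (roots Vs g) = k \<and> \<not> (\<exists>r. leads g x r \<and> leads g z r)"
    if x: "x \<in> E" and z: "z \<in> Vs - E" for x z
  proof (rule ccontr)
    assume "\<not> ?thesis"
    then have all: "\<exists>r. leads g x r \<and> leads g z r" if "g \<in> Om" "card (roots Vs g) = k" for g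
      using that by blast
    have "x \<in> X \<longleftrightarrow> z \<in> X" if X: "X \<in> Gs" for X
    proof -
      obtain g r where g: "g \<in> Om" "card (roots Vs g) = k" "X = {u \<in> Vs. leads g u r}"
        using GsD[OF X] by blast
      obtain s where "leads g x s" "leads g z s" using all g by blast
      then have "leads g x r \<longleftrightarrow> leads g z r" using leads_unique by metis
      then show ?thesis using g(3) x z EV by blast
    qed
    then have "x \<in> E \<longleftrightarrow> z \<in> E" using gen_algebra_not_separated[OF E(1), of x z] x z EV by blast
    then show False using x z by blast
  qed
  have fOm: "f \<in> Om" using Om_iff[OF f(1,2)] f(3) assms(5) by simp
  show ?thesis
    unfolding f(3)
  proof (rule single_exit_is_tree[OF f(1) is_forest_rel_of(2)[OF f(1)] EV E(2)])
    show "a = b" if "a \<in> exits f E" "b \<in> exits f E" for a b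
      by (rule atom_single_exit[OF fOm f(2) EV tog sep that])
  qed
qed

end
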